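(* Let $T\in(0,\infty)$, and let $\mu_T$, $\mu_T^{(N)}$ ($N\in\mathbb{N}$) and $\nu_k^{\Delta t}$ ($k\in\mathbb{N}_0$, $\Delta t\in(0,1)$) be the probability distributions on $H=L^2(0,1)$ defined in the context. Then \[ \limsup_{N\to\infty}\ \lambda_N^{r}\sup_{\phi\in\mathcal{C}^{0,1}(H,\mathbb{R}),\ \|\phi\|_1\le 1}\Big|\int_H\phi\,d\mu_T-\int_H\phi\,d\mu_T^{(N)}\Big|=\begin{cases}0 & \text{for all } r\in[0,\tfrac14),\\ \infty & \text{for all } r\in(\tfrac14,\tfrac12),\end{cases} \] and \[ \limsup_{\Delta t\to 0}\ \frac{1}{\Delta t^{r}}\sup_{\phi\in\mathcal{C}^{0,1}(H,\mathbb{R}),\ \|\phi\|_1\le 1}\Big|\int_H\phi\,d\mu_T-\int_H\phi\,d\nu_{\lfloor T/\Delta t\rfloor}^{\Delta t}\Big|=\begin{cases}0 & \text{for all } r\in[0,\tfrac14),\\ \infty & \text{for all } r\in(\tfrac14,\tfrac12).\end{cases} \]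
   Context: Let $H=L^2(0,1)$ with inner product $\langle\cdot,\cdot\rangle$ and norm $|\cdot|$. For $n\in\mathbb{N}=\{1,2,\ldots\}$ let $\lambda_n=\pi^2n^2$ and $e_n=\sqrt2\sin(n\pi\,\cdot)$, a complete orthonormal system of $H$. Let $A$ be the self-adjoint operator $Ax=-\sum_{n}\lambda_n\langle x,e_n\rangle e_n$ on $D(A)=\{x\in H:\sum_n\lambda_n^2\langle x,e_n\rangle^2<\infty\}$ (Dirichlet Laplacian), generating the semigroup $e^{tA}x=\sum_n e^{-\lambda_nt}\langle x,e_n\rangle e_n$. Let $(\beta_n)_{n\in\mathbb{N}}$ be independent standard real Wiener processes on a probability space and $W(t)=\sum_n\beta_n(t)e_n$ the cylindrical Wiener process. Let $X(t)=\int_0^te^{(t-s)A}dW(s)=\sum_n\big(\int_0^te^{-\lambda_n(t-s)}d\beta_n(s)\big)e_n$ be the mild solution of $dX=AX\,dt+dW$, $X(0)=0$, and let $\mu_t$ denote the law of $X(t)$ (a centered Gaussian measure on $H$ with covariance $Q_te_n=\frac{1}{2\lambda_n}(1-e^{-2\lambda_nt})e_n$). Spectral Galerkin discretization: for $N\in\mathbb{N}$, $P_N$ is the orthogonal projection onto $\mathrm{Span}(e_1,\ldots,e_N)$, $X^{(N)}(t)=P_NX(t)$ (the solution of $dX^{(N)}=AX^{(N)}dt+P_NdW$, $X^{(N)}(0)=0$), and $\mu_t^{(N)}$ is the law of $X^{(N)}(t)$. Linear implicit Euler scheme: for $\Delta t\in(0,1)$, let $S_{\Delta t}=(I-\Delta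 tA)^{-1}$, $X_0^{\Delta t}=0$, $X_{k+1}^{\Delta t}=S_{\Delta t}X_k^{\Delta t}+S_{\Delta t}\big(W((k+1)\Delta t)-W(k\Delta t)\big)$ for $k\in\mathbb{N}_0$, and $\nu_k^{\Delta t}$ is the law of $X_k^{\Delta t}$ (centered Gaussian with covariance $\Delta t\sum_{\ell=0}^{k-1}S_{\Delta t}^{2(k-\ell)}$). $\mathcal{C}^{0,1}(H,\mathbb{R})$ denotes the bounded Lipschitz continuous functions $H\to\mathbb{R}$, with $\|\phi\|_1=\sup_{x\in H}|\phi(x)|+\sup_{x\ne y}\frac{|\phi(y)-\phi(x)|}{|y-x|}$. *)

theory Defs
  imports "HOL-Probability.Probability"
begin

text \<open>Coordinates: H = L2(0,1) is identified, via the orthonormal basis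
 e_n = sqrt 2 sin(n pi .), n >= 1, with sequences x :: nat => real, where
 coordinate k stands for the coefficient of e_(k+1).\<close>

definition lam :: "nat \<Rightarrow> real" where
  "lam n = pi\<^sup>2 * (real n)\<^sup>2"

definition l2 :: "(nat \<Rightarrow> real) set" where
  "l2 = {x. summable (\<lambda>k. (x k)\<^sup>2)}"

definition l2_dist :: "(nat \<Rightarrow> real) \<Rightarrow> (nat \<Rightarrow> real) \<Rightarrow> real" where
  "l2_dist x y = sqrt (\<Sum>k. (y k - x k)\<^sup>2)"

definition BL :: "((nat \<Rightarrow> real) \<Rightarrow> real) set" where
  "BL = {\<phi>. (\<exists>B. \<forall>x\<in>l2. \<bar>\<phi> x\<bar> \<le> B) \<and>
             (\<exists>L. \<forall>x\<in>l2. \<forall>y\<in>l2. \<bar>\<phi> y - \<phi> x\<bar> \<le> L * l2_dist x y)}"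

definition BL_norm :: "((nat \<Rightarrow> real) \<Rightarrow> real) \<Rightarrow> real" where
  "BL_norm \<phi> = (SUP x\<in>l2. \<bar>\<phi> x\<bar>) +
     (SUP p\<in>{(x,y). x \<in> l2 \<and> y \<in> l2 \<and> x \<noteq> y}.
        \<bar>\<phi> (snd p) - \<phi> (fst p)\<bar> / l2_dist (fst p) (snd p))"

text \<open>A test function on H, extended by 0 outside H (the measures below are
 concentrated on H).\<close>
definition ext_H :: "((nat \<Rightarrow> real) \<Rightarrow> real) \<Rightarrow> (nat \<Rightarrow> real) \<Rightarrow> real" where
  "ext_H \<phi> x = (if x \<in> l2 then \<phi> x else 0)"

definition BL_dist :: "(nat \<Rightarrow> real) measure \<Rightarrow> (nat \<Rightarrow> real) measure \<Rightarrow> real" where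
  "BL_dist \<mu> \<nu> = (SUP \<phi>\<in>{\<phi>. \<phi> \<in> BL \<and> BL_norm \<phi> \<le> 1}.
      \<bar>(\<integral>x. ext_H \<phi> x \<partial>\<mu>) - (\<integral>x. ext_H \<phi> x \<partial>\<nu>)\<bar>)"

definition gauss :: "real \<Rightarrow> real measure" where
  "gauss v = (if v = 0 then return borel 0
              else density lborel (normal_density 0 (sqrt v)))"

text \<open>Centered Gaussian measure on H, diagonal in the basis e_(k+1),
 with variances v k: law of the sequence of independent coordinates.\<close>
definition diag_gauss :: "(nat \<Rightarrow> real) \<Rightarrow> (nat \<Rightarrow> real) measure" where
  "diag_gauss v = PiM UNIV (\<lambda>k. gauss (v k))"

text \<open>mu_t: law of X(t), covariance Q_t e_n = (1 - exp(-2 lam_n t))/(2 lam_n) e_n.\<close>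
definition mu :: "real \<Rightarrow> (nat \<Rightarrow> real) measure" where
  "mu t = diag_gauss (\<lambda>k. (1 - exp (- 2 * lam (Suc k) * t)) / (2 * lam (Suc k)))"

text \<open>mu_t^(N): law of P_N X(t).\<close>
definition mu_gal :: "real \<Rightarrow> nat \<Rightarrow> (nat \<Rightarrow> real) measure" where
  "mu_gal t N = diag_gauss (\<lambda>k. if Suc k \<le> N
      then (1 - exp (- 2 * lam (Suc k) * t)) / (2 * lam (Suc k)) else 0)"

text \<open>nu_k^dt: law of the linear implicit Euler iterate X_k^dt, covariance
 dt * sum_(l<k) S_dt^(2(k-l)), S_dt e_n = 1/(1 + dt lam_n) e_n.\<close>
definition nu :: "real \<Rightarrow> nat \<Rightarrow> (nat \<Rightarrow> real) measure" where
  "nu dt m = diag_gauss (\<lambda>k. dt * (\<Sum>l<m. (1 / (1 + dt * lam (Suc k))) ^ (2 * (m - l))))"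

end

theory Submission
  imports Defs "HOL-Real_Asymp.Real_Asymp"
begin

text \<open>Upper bounds: driving all modes by the same standard normal variables couples two diagonal
  Gaussian laws with variances \<open>v\<close> and \<open>w\<close>, and since \<open>(sqrt v - sqrt w)\<^sup>2 \<le> \<bar>v - w\<bar>\<close> their distance
  is at most the square root of \<open>\<Sum>k. \<bar>v k - w k\<bar>\<close>. For both schemes the \<open>k\<close>-th variance error is
  at most \<open>C * \<epsilon> powr \<theta> * lam (Suc k) powr (\<theta> - 1)\<close> with \<open>\<epsilon> = 1 / lam N\<close> or \<open>\<epsilon> = dt\<close>, by interpolating
  between a consistency bound and a smoothing bound; this is summable for every \<open>\<theta> < 1 / 2\<close>, giving
  every rate below \<open>1 / 4\<close>.

  Lower bounds: in the block of modes \<open>N, ..., 2N - 1\<close> (with \<open>N\<close> of order \<open>1 / sqrt dt\<close> for the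
  Euler scheme) the scheme loses a fixed fraction of the variance, which is of order \<open>1 / N\<^sup>2\<close> per
  mode. The test function \<open>exp (- N * \<bar>x\<bar>\<^sup>2) / (2 * sqrt N)\<close> of the coordinates in this block has norm
  at most 1, and its two expectations are explicit products that differ by a constant multiple of
  \<open>1 / sqrt N\<close>, that is of \<open>lam N powr (- 1 / 4)\<close> or \<open>dt powr (1 / 4)\<close>.\<close>

section \<open>Diagonal Gaussian measures\<close>

lemma space_gauss [simp]: "space (gauss v) = UNIV"
  by (simp add: gauss_def)

lemma sets_gauss [simp, measurable_cong]: "sets (gauss v) = sets borel"
  by (simp add: gauss_def)

lemma prob_space_gauss:
  assumes "0 \<le> v"
  shows "prob_space (gauss v)"
proof (cases "v = 0")
  case True
  then show ?thesis by (simp add: gauss_def prob_space_return)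
next
  case False
  then show ?thesis
    using assms by (simp add: gauss_def prob_space_normal_density)
qed

text \<open>Every centered normal law, including the Dirac mass at \<open>v = 0\<close>, is an image
  of the same standard normal law. This is what makes it possible to drive two laws by common
  noise.\<close>

lemma gauss_scale:
  assumes "0 \<le> v"
  shows "distr (gauss 1) borel (\<lambda>x. sqrt v * x) = gauss v"
proof (cases "v = 0")
  case True
  interpret prob_space "gauss 1" by (rule prob_space_gauss) simp
  show ?thesis using True
    by (intro measure_eqI)
       (auto simp: gauss_def[of 0] emeasure_distr emeasure_space_1[simplified] indicator_def)
next
  case False
  interpret prob_space "gauss 1" by (rule prob_space_gauss) simp
  have "distributed (gauss 1) lborel (\<lambda>x. x) (normal_density 0 1)"
    by (simp add: distributed_def gauss_def distr_id2)
  from normal_density_affine[OF this, of "sqrt v" 0]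
  have "distributed (gauss 1) lborel (\<lambda>x. sqrt v * x) (normal_density 0 (sqrt v))"
    using False assms by simp
  then have "distr (gauss 1) lborel (\<lambda>x. sqrt v * x) = density lborel (normal_density 0 (sqrt v))"
    by (simp add: distributed_def)
  moreover have "distr (gauss 1) borel (\<lambda>x. sqrt v * x) = distr (gauss 1) lborel (\<lambda>x. sqrt v * x)"
    by (rule distr_cong) auto
  ultimately show ?thesis
    using False by (simp add: gauss_def)
qed

lemma nn_integral_gauss_square:
  assumes "0 \<le> v"
  shows "(\<integral>\<^sup>+x. ennreal (x\<^sup>2) \<partial>gauss v) = ennreal v"
proof (cases "v = 0")
  case True
  then show ?thesis by (simp add: gauss_def nn_integral_return)
next
  case False
  then have v: "0 < sqrt v" using assms by simp
  have "has_bochner_integral lborel (\<lambda>x. normal_density 0 (sqrt v) x * x\<^sup>2) v"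
    using normal_moment_even[OF v, of 0 1] False assms by simp
  then have "(\<integral>\<^sup>+x. ennreal (normal_density 0 (sqrt v) x * x\<^sup>2) \<partial>lborel) = ennreal v"
    by (subst nn_integral_eq_integral) (auto simp: has_bochner_integral_iff)
  then show ?thesis
    using False by (simp add: gauss_def nn_integral_density ennreal_mult)
qed

text \<open>Multiplying the density by the exponential gives \<open>1 / sqrt b\<close> times the
  centered normal density of variance \<open>v / b\<close>, with \<open>b = 1 + 2 * a * v\<close>,
  and that density has total mass 1.\<close>

lemma integral_gauss_exp:
  assumes "0 \<le> v" "0 \<le> a"
  shows "(\<integral>x. exp (- a * x\<^sup>2) \<partial>gauss v) = 1 / sqrt (1 + 2 * a * v)"
proof (cases "v = 0")
  case True
  then show ?thesis by (simp add: gauss_def integral_return)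
next
  case False
  then have v: "0 < v" using assms by simp
  define b where "b = 1 + 2 * a * v"
  have b: "0 < b" using v assms unfolding b_def by (simp add: add_pos_nonneg)
  have eq: "normal_density 0 (sqrt v) x * exp (- a * x\<^sup>2)
      = 1 / sqrt b * normal_density 0 (sqrt (v / b)) x" for x
  proof -
    have "- x\<^sup>2 / (2 * v) + - a * x\<^sup>2 = - x\<^sup>2 / (2 * (v / b))"
      using v b by (simp add: b_def field_simps)
    then have "exp (- x\<^sup>2 / (2 * v)) * exp (- a * x\<^sup>2) = exp (- x\<^sup>2 / (2 * (v / b)))"
      by (metis exp_add)
    then show ?thesis
      using v b by (simp add: normal_density_def real_sqrt_mult real_sqrt_divide field_simps)
  qed
  have "(\<integral>x. exp (- a * x\<^sup>2) \<partial>gauss v) = (\<integral>x. normal_density 0 (sqrt v) x * exp (- a * x\<^sup>2) \<partial>lborel)"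
    using False by (simp add: gauss_def integral_density)
  also have "\<dots> = 1 / sqrt b"
    unfolding eq using v b by simp
  finally show ?thesis by (simp add: b_def)
qed

lemma sets_diag_gauss [measurable_cong]:
  "sets (diag_gauss v) = sets (PiM UNIV (\<lambda>_. borel))"
  unfolding diag_gauss_def by (intro sets_PiM_cong) auto

lemma space_diag_gauss [simp]: "space (diag_gauss v) = UNIV"
  by (simp add: diag_gauss_def space_PiM PiE_def extensional_def)

lemma prob_space_diag_gauss:
  assumes "\<And>k. 0 \<le> v k"
  shows "prob_space (diag_gauss v)"
  unfolding diag_gauss_def by (intro prob_space_PiM prob_space_gauss assms)

lemma distr_diag_gauss_coordinate:
  assumes "\<And>k. 0 \<le> v k"
  shows "distr (diag_gauss v) borel (\<lambda>x. x k) = gauss (v k)"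
proof -
  have "distr (diag_gauss v) (gauss (v k)) (\<lambda>x. x k) = gauss (v k)"
    unfolding diag_gauss_def
    by (rule distr_PiM_component) (auto intro: prob_space_gauss assms)
  moreover have "distr (diag_gauss v) borel (\<lambda>x. x k) = distr (diag_gauss v) (gauss (v k)) (\<lambda>x. x k)"
    by (rule distr_cong) auto
  ultimately show ?thesis by simp
qed

text \<open>The joint law of the coordinates is the measure itself, which is the product of its
  marginals; this equality characterizes independence.\<close>

lemma indep_vars_diag_gauss:
  assumes "\<And>k. 0 \<le> v k"
  shows "prob_space.indep_vars (diag_gauss v) (\<lambda>_. borel) (\<lambda>k x. x k) UNIV"
proof -
  interpret prob_space "diag_gauss v" using assms by (rule prob_space_diag_gauss)
  have rv: "(\<lambda>x. x k) \<in> borel_measurable (diag_gauss v)" for k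
    by measurable
  have "distr (diag_gauss v) (PiM UNIV (\<lambda>_. borel)) (\<lambda>x. \<lambda>k\<in>UNIV. x k) = diag_gauss v"
    by (simp add: restrict_UNIV distr_id2 sets_diag_gauss)
  also have "\<dots> = (\<Pi>\<^sub>M k\<in>UNIV. distr (diag_gauss v) borel (\<lambda>x. x k))"
    unfolding distr_diag_gauss_coordinate[OF assms] by (simp add: diag_gauss_def)
  finally show ?thesis
    using indep_vars_iff_distr_eq_PiM[where I=UNIV and M'="\<lambda>_. borel" and X="\<lambda>k x. x k"] rv by simp
qed

text \<open>Scaled coordinates stay independent and have laws \<open>gauss (v k)\<close>, so their
  joint law is the product. All diagonal Gaussian laws thus live on one probability space.\<close>

lemma diag_gauss_scale:
  assumes "\<And>k. 0 \<le> v k"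
  shows "distr (diag_gauss (\<lambda>_. 1)) (PiM UNIV (\<lambda>_. borel)) (\<lambda>z k. sqrt (v k) * z k) = diag_gauss v"
proof -
  interpret prob_space "diag_gauss (\<lambda>_. 1)" by (rule prob_space_diag_gauss) simp
  have rv: "(\<lambda>x. sqrt (v k) * x k) \<in> borel_measurable (diag_gauss (\<lambda>_. 1))" for k
    by measurable
  have "indep_vars (\<lambda>_. borel) (\<lambda>k x. sqrt (v k) * x k) UNIV"
    by (rule indep_vars_compose2[OF indep_vars_diag_gauss]) auto
  then have "distr (diag_gauss (\<lambda>_. 1)) (PiM UNIV (\<lambda>_. borel)) (\<lambda>x. \<lambda>k\<in>UNIV. sqrt (v k) * x k)
      = (\<Pi>\<^sub>M k\<in>UNIV. distr (diag_gauss (\<lambda>_. 1)) borel (\<lambda>x. sqrt (v k) * x k))"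
    using indep_vars_iff_distr_eq_PiM[where I=UNIV and M'="\<lambda>_. borel" and X="\<lambda>k x. sqrt (v k) * x k"] rv by simp
  moreover have "distr (diag_gauss (\<lambda>_. 1)) borel (\<lambda>x. sqrt (v k) * x k) = gauss (v k)" for k
  proof -
    have "distr (diag_gauss (\<lambda>_. 1)) borel (\<lambda>x. sqrt (v k) * x k)
        = distr (distr (diag_gauss (\<lambda>_. 1)) borel (\<lambda>x. x k)) borel (\<lambda>x. sqrt (v k) * x)"
      by (subst distr_distr) (auto simp: comp_def)
    also have "\<dots> = gauss (v k)"
      using assms distr_diag_gauss_coordinate[of "\<lambda>_. 1"] by (simp add: gauss_scale)
    finally show ?thesis .
  qed
  ultimately show ?thesis
    by (simp add: diag_gauss_def restrict_UNIV)
qed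

text \<open>Tonelli in the extended nonnegative reals, so sum and integral can be exchanged before
  any summability is known.\<close>

lemma nn_integral_diag_gauss_weighted:
  assumes "\<And>k. 0 \<le> v k" "\<And>k. 0 \<le> c k"
  shows "(\<integral>\<^sup>+x. (\<Sum>k. ennreal (c k * (x k)\<^sup>2)) \<partial>diag_gauss v) = (\<Sum>k. ennreal (c k * v k))"
proof -
  have "(\<integral>\<^sup>+x. ennreal (c k * (x k)\<^sup>2) \<partial>diag_gauss v) = ennreal (c k * v k)" for k
  proof -
    have "(\<integral>\<^sup>+x. ennreal ((x k)\<^sup>2) \<partial>diag_gauss v) = (\<integral>\<^sup>+x. ennreal (x\<^sup>2) \<partial>gauss (v k))"
      by (subst distr_diag_gauss_coordinate[OF assms(1), symmetric], subst nn_integral_distr) auto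
    also have "\<dots> = ennreal (v k)"
      by (rule nn_integral_gauss_square[OF assms(1)])
    finally show ?thesis
      using assms by (simp add: ennreal_mult nn_integral_cmult)
  qed
  then show ?thesis
    by (subst nn_integral_suminf) auto
qed

text \<open>A finite expectation forces almost sure finiteness. With \<open>c = 1\<close> this gives
  concentration on \<open>l2\<close>; with \<open>v = 1\<close> it handles series of weighted
  standard normal variables.\<close>

lemma AE_diag_gauss_summable:
  assumes "\<And>k. 0 \<le> v k" "\<And>k. 0 \<le> c k" "summable (\<lambda>k. c k * v k)"
  shows "AE x in diag_gauss v. summable (\<lambda>k. c k * (x k)\<^sup>2)"
proof -
  have "(\<integral>\<^sup>+x. (\<Sum>k. ennreal (c k * (x k)\<^sup>2)) \<partial>diag_gauss v) \<noteq> \<infinity>"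
    using assms by (simp add: nn_integral_diag_gauss_weighted ennreal_suminf_neq_top)
  then have "AE x in diag_gauss v. (\<Sum>k. ennreal (c k * (x k)\<^sup>2)) \<noteq> \<infinity>"
    by (intro nn_integral_PInf_AE) auto
  then show ?thesis
    by eventually_elim (rule summable_suminf_not_top, use assms in auto)
qed

lemma AE_diag_gauss_l2:
  assumes "\<And>k. 0 \<le> v k" "summable v"
  shows "AE x in diag_gauss v. x \<in> l2"
  using AE_diag_gauss_summable[of v "\<lambda>_. 1"] assms by (simp add: l2_def)

text \<open>Summability is rewritten as finiteness of an extended series, whose value depends
  measurably on the sequence.\<close>

lemma l2_measurable [measurable]: "l2 \<in> sets (PiM UNIV (\<lambda>_. borel))"
proof -
  have "l2 = {x \<in> space (PiM UNIV (\<lambda>_. borel)). (\<Sum>k. ennreal ((x k)\<^sup>2)) \<noteq> \<infinity>}"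
    by (auto simp: l2_def space_PiM ennreal_suminf_neq_top intro: summable_suminf_not_top)
  also have "\<dots> \<in> sets (PiM UNIV (\<lambda>_. borel))"
    by measurable
  finally show ?thesis .
qed

lemma integral_diag_gauss_exp:
  assumes "\<And>k. 0 \<le> v k" "0 \<le> a" "finite K"
  shows "(\<integral>x. exp (- a * (\<Sum>k\<in>K. (x k)\<^sup>2)) \<partial>diag_gauss v) = (\<Prod>k\<in>K. 1 / sqrt (1 + 2 * a * v k))"
proof -
  interpret prob_space "diag_gauss v" using assms(1) by (rule prob_space_diag_gauss)
  have "(\<integral>x. exp (- a * (\<Sum>k\<in>K. (x k)\<^sup>2)) \<partial>diag_gauss v)
      = (\<integral>x. (\<Prod>k\<in>K. exp (- a * (x k)\<^sup>2)) \<partial>diag_gauss v)"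
    using assms by (simp add: exp_sum sum_distrib_left flip: sum_negf)
  also have "\<dots> = (\<Prod>k\<in>K. \<integral>x. exp (- a * (x k)\<^sup>2) \<partial>diag_gauss v)"
  proof (rule indep_vars_lebesgue_integral[OF assms(3)])
    show "indep_vars (\<lambda>_. borel) (\<lambda>k x. exp (- a * (x k)\<^sup>2)) K"
      by (rule indep_vars_compose2[OF indep_vars_subset[OF indep_vars_diag_gauss[OF assms(1)]]]) auto
    show "integrable (diag_gauss v) (\<lambda>x. exp (- a * (x k)\<^sup>2))" for k
      by (rule integrable_const_bound[where B=1]) (use assms in auto)
  qed
  finally have prod: "(\<integral>x. exp (- a * (\<Sum>k\<in>K. (x k)\<^sup>2)) \<partial>diag_gauss v)
      = (\<Prod>k\<in>K. \<integral>x. exp (- a * (x k)\<^sup>2) \<partial>diag_gauss v)" .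
  have "(\<integral>x. exp (- a * (x k)\<^sup>2) \<partial>diag_gauss v) = 1 / sqrt (1 + 2 * a * v k)" for k
  proof -
    have "(\<integral>x. exp (- a * (x k)\<^sup>2) \<partial>diag_gauss v) = (\<integral>x. exp (- a * x\<^sup>2) \<partial>gauss (v k))"
      by (subst distr_diag_gauss_coordinate[OF assms(1), symmetric], subst integral_distr) auto
    then show ?thesis using assms by (simp only: integral_gauss_exp)
  qed
  then show ?thesis unfolding prod by simp
qed

section \<open>The bounded Lipschitz distance of diagonal Gaussian measures\<close>

lemma summable_l2_diff:
  assumes "x \<in> l2" "y \<in> l2"
  shows "summable (\<lambda>k. (y k - x k)\<^sup>2)"
proof (rule summable_comparison_test')
  show "summable (\<lambda>k. 2 * (y k)\<^sup>2 + 2 * (x k)\<^sup>2)"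
    using assms by (intro summable_add summable_mult) (auto simp: l2_def)
  show "norm ((y k - x k)\<^sup>2) \<le> 2 * (y k)\<^sup>2 + 2 * (x k)\<^sup>2" if "k \<ge> 0" for k
  proof -
    \<comment> \<open>The difference of the two sides is the square of
      \<open>y k + x k\<close>.\<close>
    have "(y k - x k)\<^sup>2 \<le> 2 * (y k)\<^sup>2 + 2 * (x k)\<^sup>2"
      using zero_le_power2[of "y k + x k"] by (simp add: power2_sum power2_diff del: zero_le_power2)
    then show ?thesis by simp
  qed
qed

lemma l2_dist_pos:
  assumes "x \<in> l2" "y \<in> l2" "x \<noteq> y"
  shows "0 < l2_dist x y"
proof -
  obtain k where "x k \<noteq> y k" using assms(3) by blast
  then have "0 < (\<Sum>k. (y k - x k)\<^sup>2)"
    by (intro suminf_pos2[OF summable_l2_diff[OF assms(1,2)], where i=k]) auto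
  then show ?thesis by (simp add: l2_dist_def)
qed

lemma l2_dist_refl [simp]: "l2_dist x x = 0"
  by (simp add: l2_dist_def)

lemma zero_in_l2: "(\<lambda>_. 0) \<in> l2"
  by (simp add: l2_def)

text \<open>A real supremum over the empty set carries no information, so the Lipschitz part of
  \<open>BL_norm\<close> must be known to range over at least one pair.\<close>

lemma l2_pairs_nonempty: "{(x, y). x \<in> l2 \<and> y \<in> l2 \<and> x \<noteq> y} \<noteq> {}"
proof -
  define u :: "nat \<Rightarrow> real" where "u = (\<lambda>k. if k = 0 then 1 else 0)"
  have "u \<in> l2"
    unfolding l2_def u_def by (auto intro!: summable_finite[of "{0}"] split: if_splits)
  moreover have "u \<noteq> (\<lambda>_. 0)"
    by (auto simp: u_def fun_eq_iff)
  ultimately have "((\<lambda>_. 0), u) \<in> {(x, y). x \<in> l2 \<and> y \<in> l2 \<and> x \<noteq> y}"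
    using zero_in_l2 by auto
  then show ?thesis by blast
qed

text \<open>A real supremum dominates its members only over a bounded set; membership in
  \<open>BL\<close> supplies the bounds. Both suprema are nonnegative, so each of them is at most
  1.\<close>

lemma BL_norm_le_1D:
  assumes "\<phi> \<in> BL" "BL_norm \<phi> \<le> 1"
  shows "x \<in> l2 \<Longrightarrow> \<bar>\<phi> x\<bar> \<le> 1"
    and "x \<in> l2 \<Longrightarrow> y \<in> l2 \<Longrightarrow> \<bar>\<phi> y - \<phi> x\<bar> \<le> l2_dist x y"
proof -
  define S where "S = {(x, y). x \<in> l2 \<and> y \<in> l2 \<and> x \<noteq> y}"
  define q where "q p = \<bar>\<phi> (snd p) - \<phi> (fst p)\<bar> / l2_dist (fst p) (snd p)" for p
  obtain A where A: "\<And>x. x \<in> l2 \<Longrightarrow> \<bar>\<phi> x\<bar> \<le> A"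
    using assms(1) by (auto simp: BL_def)
  obtain L where L: "\<And>x y. x \<in> l2 \<Longrightarrow> y \<in> l2 \<Longrightarrow> \<bar>\<phi> y - \<phi> x\<bar> \<le> L * l2_dist x y"
    using assms(1) by (auto simp: BL_def)
  have norm: "(SUP x\<in>l2. \<bar>\<phi> x\<bar>) + (SUP p\<in>S. q p) \<le> 1"
    using assms(2) by (simp add: BL_norm_def S_def q_def)
  have sup1: "\<bar>\<phi> x\<bar> \<le> (SUP x\<in>l2. \<bar>\<phi> x\<bar>)" if "x \<in> l2" for x
    using that A by (intro cSUP_upper bdd_aboveI2[where M=A]) auto
  have "q p \<le> L" if "p \<in> S" for p
    using that L[of "fst p" "snd p"] l2_dist_pos[of "fst p" "snd p"]
    by (auto simp: q_def S_def divide_le_eq)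
  then have sup2: "q p \<le> (SUP p\<in>S. q p)" if "p \<in> S" for p
    using that by (intro cSUP_upper bdd_aboveI2[where M=L]) auto
  have q_nonneg: "0 \<le> q p" if "p \<in> S" for p
    using that l2_dist_pos[of "fst p" "snd p"] by (auto simp: q_def S_def intro!: divide_nonneg_pos)
  obtain p0 where "p0 \<in> S" using l2_pairs_nonempty unfolding S_def by blast
  then have pos2: "0 \<le> (SUP p\<in>S. q p)"
    using sup2 q_nonneg order_trans by blast
  have pos1: "0 \<le> (SUP x\<in>l2. \<bar>\<phi> x\<bar>)"
    using sup1[OF zero_in_l2] by linarith
  show "\<bar>\<phi> x\<bar> \<le> 1" if "x \<in> l2" for x
    using sup1[OF that] pos2 norm by linarith
  show "\<bar>\<phi> y - \<phi> x\<bar> \<le> l2_dist x y" if "x \<in> l2" "y \<in> l2" for x y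
  proof (cases "x = y")
    case False
    then have "(x, y) \<in> S" using that by (simp add: S_def)
    then have "q (x, y) \<le> 1" using sup2 pos1 norm by fastforce
    then show ?thesis
      using l2_dist_pos[OF that False] by (simp add: q_def divide_le_eq)
  qed simp
qed

lemma BL_normI:
  assumes "\<And>x. x \<in> l2 \<Longrightarrow> \<bar>\<phi> x\<bar> \<le> A"
    and "\<And>x y. x \<in> l2 \<Longrightarrow> y \<in> l2 \<Longrightarrow> \<bar>\<phi> y - \<phi> x\<bar> \<le> L * l2_dist x y"
  shows "\<phi> \<in> BL" "BL_norm \<phi> \<le> A + L"
proof -
  show "\<phi> \<in> BL" using assms by (auto simp: BL_def)
  show "BL_norm \<phi> \<le> A + L"
    unfolding BL_norm_def
  proof (rule add_mono)
    show "(SUP x\<in>l2. \<bar>\<phi> x\<bar>) \<le> A"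
      using assms(1) zero_in_l2 by (intro cSUP_least) auto
    show "(SUP p\<in>{(x, y). x \<in> l2 \<and> y \<in> l2 \<and> x \<noteq> y}.
        \<bar>\<phi> (snd p) - \<phi> (fst p)\<bar> / l2_dist (fst p) (snd p)) \<le> L"
    proof (rule cSUP_least[OF l2_pairs_nonempty])
      fix p assume "p \<in> {(x, y). x \<in> l2 \<and> y \<in> l2 \<and> x \<noteq> y}"
      then show "\<bar>\<phi> (snd p) - \<phi> (fst p)\<bar> / l2_dist (fst p) (snd p) \<le> L"
        using assms(2)[of "fst p" "snd p"] l2_dist_pos[of "fst p" "snd p"]
        by (auto simp: divide_le_eq)
    qed
  qed
qed

section \<open>Upper bound by synchronous coupling\<close>

lemma sqrt_diff_square_le:
  fixes a b :: real
  assumes "0 \<le> a" "0 \<le> b"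
  shows "(sqrt a - sqrt b)\<^sup>2 \<le> \<bar>a - b\<bar>"
proof -
  \<comment> \<open>One factor of the square is enlarged to the sum of the roots, which completes a
    difference of squares.\<close>
  have "\<bar>sqrt a - sqrt b\<bar> * \<bar>sqrt a - sqrt b\<bar> \<le> \<bar>sqrt a - sqrt b\<bar> * \<bar>sqrt a + sqrt b\<bar>"
    using assms by (intro mult_left_mono) (auto simp: abs_le_iff)
  also have "\<dots> = \<bar>(sqrt a - sqrt b) * (sqrt a + sqrt b)\<bar>"
    by (rule abs_mult[symmetric])
  also have "(sqrt a - sqrt b) * (sqrt a + sqrt b) = a - b"
    using assms by (simp add: algebra_simps)
  finally show ?thesis by (simp add: power2_eq_square flip: abs_mult)
qed

text \<open>The synchronous coupling of the two Gaussian laws, with the square root in the \<open>l2\<close> distance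
  removed by \<open>sqrt D \<le> s / 2 + D / (2 * s)\<close>. If the extended test function is not measurable, both
  integrals take the default value 0.\<close>

lemma BL_integral_diff_le:
  assumes v: "\<And>k. 0 \<le> v k" "summable v" and w: "\<And>k. 0 \<le> w k" "summable w"
    and s: "0 < s" "(\<Sum>k. \<bar>v k - w k\<bar>) \<le> s\<^sup>2"
    and \<phi>: "\<phi> \<in> BL" "BL_norm \<phi> \<le> 1"
  shows "\<bar>(\<integral>x. ext_H \<phi> x \<partial>diag_gauss v) - (\<integral>x. ext_H \<phi> x \<partial>diag_gauss w)\<bar> \<le> s"
proof (cases "ext_H \<phi> \<in> borel_measurable (PiM UNIV (\<lambda>_. borel))")
  case False
  then have "\<not> integrable (diag_gauss u) (ext_H \<phi>)" for u
    using borel_measurable_integrable measurable_cong_sets[OF sets_diag_gauss refl] by blast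
  then show ?thesis using s by (simp add: not_integrable_integral_eq)
next
  case True
  note [measurable] = True
  let ?M = "diag_gauss (\<lambda>_. 1)"
  interpret prob_space ?M by (rule prob_space_diag_gauss) simp
  define f where "f u z = ext_H \<phi> (\<lambda>k. sqrt (u k) * z k)" for u z :: "nat \<Rightarrow> real"
  have scale_meas [measurable]: "(\<lambda>z k. sqrt (u k) * z k) \<in> ?M \<rightarrow>\<^sub>M PiM UNIV (\<lambda>_. borel)"
    for u :: "nat \<Rightarrow> real"
    using measurable_restrict[of UNIV "\<lambda>k z. sqrt (u k) * z k" ?M "\<lambda>_. borel"]
    by (simp add: restrict_UNIV)
  have f_meas [measurable]: "f u \<in> borel_measurable ?M" for u
    unfolding f_def by (rule measurable_compose[OF scale_meas True])
  have int_f: "(\<integral>x. ext_H \<phi> x \<partial>diag_gauss u) = (\<integral>z. f u z \<partial>?M)" if "\<And>k. 0 \<le> u k" for u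
    unfolding f_def by (subst diag_gauss_scale[OF that, symmetric], subst integral_distr) measurable
  have integrable_f: "integrable ?M (f u)" for u
    using BL_norm_le_1D(1)[OF \<phi>]
    by (intro integrable_const_bound[where B=1]) (auto simp: f_def ext_H_def)
  \<comment> \<open>\<open>c k * (z k)\<^sup>2\<close> is the squared gap between the
    \<open>k\<close>-th coordinates of the two coupled sequences.\<close>
  define c where "c k = (sqrt (v k) - sqrt (w k))\<^sup>2" for k
  have c: "0 \<le> c k" "c k \<le> \<bar>v k - w k\<bar>" for k
    using v w by (simp_all add: c_def sqrt_diff_square_le)
  have sum_vw: "summable (\<lambda>k. \<bar>v k - w k\<bar>)"
  proof (rule summable_comparison_test')
    show "summable (\<lambda>k. v k + w k)" using v w by (intro summable_add)
    show "norm \<bar>v k - w k\<bar> \<le> v k + w k" if "k \<ge> 0" for k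
      using v(1)[of k] w(1)[of k] by simp
  qed
  have sum_c: "summable c"
    by (rule summable_comparison_test'[OF sum_vw]) (use c in auto)
  have "suminf c \<le> s\<^sup>2"
    using suminf_le[OF c(2) sum_c sum_vw] s(2) by simp
  \<comment> \<open>The squared coupling distance, extended-valued so that its expectation can be
    computed without integrability questions.\<close>
  define D where "D z = (\<Sum>k. ennreal (c k * (z k)\<^sup>2))" for z :: "nat \<Rightarrow> real"
  have D_meas [measurable]: "D \<in> borel_measurable ?M"
    unfolding D_def by measurable
  have "(\<integral>\<^sup>+z. D z \<partial>?M) = (\<Sum>k. ennreal (c k))"
    unfolding D_def using c by (subst nn_integral_diag_gauss_weighted) auto
  also have "\<dots> = ennreal (suminf c)"
    using c sum_c by (intro suminf_ennreal2) auto
  finally have int_D: "(\<integral>\<^sup>+z. D z \<partial>?M) = ennreal (suminf c)" .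
  have l2: "AE z in ?M. (\<lambda>k. sqrt (u k) * z k) \<in> l2" if "\<And>k. 0 \<le> u k" "summable u" for u
    using AE_diag_gauss_summable[of "\<lambda>_. 1" u] that by (simp add: l2_def power_mult_distrib)
  have "AE z in ?M. summable (\<lambda>k. c k * (z k)\<^sup>2)"
    using AE_diag_gauss_summable[of "\<lambda>_. 1" c] c sum_c by simp
  then have bound: "AE z in ?M. ennreal \<bar>f v z - f w z\<bar> \<le> ennreal (s / 2) + ennreal (1 / (2 * s)) * D z"
    using l2[OF v] l2[OF w]
  proof eventually_elim
    case (elim z)
    let ?d = "\<Sum>k. c k * (z k)\<^sup>2"
    have d: "0 \<le> ?d" using elim c by (intro suminf_nonneg) auto
    have "\<bar>f v z - f w z\<bar> \<le> l2_dist (\<lambda>k. sqrt (w k) * z k) (\<lambda>k. sqrt (v k) * z k)"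
      using BL_norm_le_1D(2)[OF \<phi>] elim by (simp add: f_def ext_H_def)
    also have "\<dots> = sqrt ?d"
      by (simp add: l2_dist_def c_def power_mult_distrib flip: left_diff_distrib)
    also have "\<dots> \<le> s / 2 + 1 / (2 * s) * ?d"
    proof -
      have "0 \<le> (sqrt ?d - s)\<^sup>2" by simp
      then have "2 * s * sqrt ?d \<le> s\<^sup>2 + ?d"
        using d by (simp add: power2_diff algebra_simps)
      then show ?thesis using s by (simp add: field_simps power2_eq_square)
    qed
    finally have "ennreal \<bar>f v z - f w z\<bar> \<le> ennreal (s / 2 + 1 / (2 * s) * ?d)"
      by (rule ennreal_leI)
    also have "\<dots> = ennreal (s / 2) + ennreal (1 / (2 * s)) * ennreal ?d"
      using s d by (subst ennreal_plus) (auto simp flip: ennreal_mult)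
    also have "ennreal ?d = D z"
      unfolding D_def using c elim by (intro suminf_ennreal2[symmetric]) auto
    finally show ?case .
  qed
  have "(\<integral>\<^sup>+z. ennreal \<bar>f v z - f w z\<bar> \<partial>?M)
      \<le> (\<integral>\<^sup>+z. ennreal (s / 2) + ennreal (1 / (2 * s)) * D z \<partial>?M)"
    by (rule nn_integral_mono_AE[OF bound])
  also have "\<dots> = ennreal (s / 2) + ennreal (1 / (2 * s)) * ennreal (suminf c)"
    by (simp add: nn_integral_add nn_integral_cmult int_D emeasure_space_1[simplified])
  also have "\<dots> = ennreal (s / 2 + 1 / (2 * s) * suminf c)"
    using s suminf_nonneg[OF sum_c c(1)] by (subst ennreal_plus) (auto simp flip: ennreal_mult)
  also have "\<dots> \<le> ennreal s"
  proof (rule ennreal_leI)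
    have "1 / (2 * s) * suminf c \<le> 1 / (2 * s) * s\<^sup>2"
      using s \<open>suminf c \<le> s\<^sup>2\<close> by (intro mult_left_mono) auto
    also have "\<dots> = s / 2" using s by (simp add: power2_eq_square)
    finally show "s / 2 + 1 / (2 * s) * suminf c \<le> s" by simp
  qed
  finally have "(\<integral>z. \<bar>f v z - f w z\<bar> \<partial>?M) \<le> s"
    using s by (intro integral_real_bounded) auto
  moreover have "\<bar>(\<integral>z. f v z - f w z \<partial>?M)\<bar> \<le> (\<integral>z. \<bar>f v z - f w z\<bar> \<partial>?M)"
    by (rule integral_abs_bound)
  ultimately show ?thesis
    using int_f[OF v(1)] int_f[OF w(1)] integrable_f by simp
qed

lemma zero_BL: "(\<lambda>_. 0) \<in> BL" "BL_norm (\<lambda>_. 0) \<le> 1"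
  using BL_normI[of "\<lambda>_. 0" 0 0] by auto

lemma BL_dist_le:
  assumes "\<And>k. 0 \<le> v k" "summable v" "\<And>k. 0 \<le> w k" "summable w"
    and "0 < s" "(\<Sum>k. \<bar>v k - w k\<bar>) \<le> s\<^sup>2"
  shows "BL_dist (diag_gauss v) (diag_gauss w) \<le> s"
  unfolding BL_dist_def
  by (rule cSUP_least) (use zero_BL BL_integral_diff_le[OF assms] in auto)

text \<open>The coupling bound makes the set of integral differences bounded above, so the supremum
  dominates each of its members.\<close>

lemma BL_dist_ge:
  assumes "\<And>k. 0 \<le> v k" "summable v" "\<And>k. 0 \<le> w k" "summable w"
    and "\<phi> \<in> BL" "BL_norm \<phi> \<le> 1"
  shows "\<bar>(\<integral>x. ext_H \<phi> x \<partial>diag_gauss v) - (\<integral>x. ext_H \<phi> x \<partial>diag_gauss w)\<bar>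
    \<le> BL_dist (diag_gauss v) (diag_gauss w)"
proof -
  \<comment> \<open>Any crude bound will do: a real \<open>S\<close> satisfies
    \<open>S \<le> (1 + \<bar>S\<bar>)\<^sup>2\<close>.\<close>
  define s where "s = 1 + \<bar>\<Sum>k. \<bar>v k - w k\<bar>\<bar>"
  have s: "0 < s" "(\<Sum>k. \<bar>v k - w k\<bar>) \<le> s\<^sup>2"
    using zero_le_power2[of "\<Sum>k. \<bar>v k - w k\<bar>"] abs_ge_self[of "\<Sum>k. \<bar>v k - w k\<bar>"]
    unfolding s_def by (simp_all only: power2_sum power2_abs power_one)
  show ?thesis
    unfolding BL_dist_def
  proof (rule cSUP_upper)
    show "\<phi> \<in> {\<phi>. \<phi> \<in> BL \<and> BL_norm \<phi> \<le> 1}"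
      using assms by simp
    show "bdd_above ((\<lambda>\<phi>. \<bar>(\<integral>x. ext_H \<phi> x \<partial>diag_gauss v) - (\<integral>x. ext_H \<phi> x \<partial>diag_gauss w)\<bar>)
        ` {\<phi>. \<phi> \<in> BL \<and> BL_norm \<phi> \<le> 1})"
      using BL_integral_diff_le[OF assms(1-4) s] by (intro bdd_aboveI2[where M=s]) auto
  qed
qed

lemma BL_dist_nonneg:
  assumes "\<And>k. 0 \<le> v k" "summable v" "\<And>k. 0 \<le> w k" "summable w"
  shows "0 \<le> BL_dist (diag_gauss v) (diag_gauss w)"
  using BL_dist_ge[OF assms zero_BL] by linarith

section \<open>Lower bound by exponential test functions\<close>

lemma exp_neg_square_lipschitz:
  fixes s t :: real
  shows "\<bar>exp (- s\<^sup>2) - exp (- t\<^sup>2)\<bar> \<le> \<bar>s - t\<bar>"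
proof -
  have deriv: "((\<lambda>u. exp (- u\<^sup>2)) has_real_derivative - 2 * u * exp (- u\<^sup>2)) (at u within UNIV)" for u :: real
    by (auto intro!: derivative_eq_intros)
  have bound: "norm (- 2 * u * exp (- u\<^sup>2)) \<le> 1" for u :: real
  proof -
    \<comment> \<open>The derivative is bounded by 1 because
      \<open>2 * \<bar>u\<bar> \<le> 1 + u\<^sup>2 \<le> exp (u\<^sup>2)\<close>.\<close>
    have "2 * \<bar>u\<bar> \<le> 1 + u\<^sup>2"
      using zero_le_power2[of "\<bar>u\<bar> - 1"] by (simp add: power2_diff)
    also have "\<dots> \<le> exp (u\<^sup>2)" by (rule exp_ge_add_one_self)
    finally show ?thesis by (simp add: abs_mult exp_minus field_simps)
  qed
  show ?thesis
    using field_differentiable_bound[OF convex_UNIV deriv bound] by simp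
qed

text \<open>The reverse triangle inequality for the norm of a finite block, which is dominated by
  the full norm.\<close>

lemma L2_set_diff_le_l2_dist:
  assumes "finite K" "x \<in> l2" "y \<in> l2"
  shows "\<bar>L2_set y K - L2_set x K\<bar> \<le> l2_dist x y"
proof -
  have "(\<Sum>k\<in>K. (y k - x k)\<^sup>2) \<le> (\<Sum>k. (y k - x k)\<^sup>2)"
    using assms by (intro sum_le_suminf summable_l2_diff) auto
  then have d: "L2_set (\<lambda>k. y k - x k) K \<le> l2_dist x y"
    by (simp add: L2_set_def l2_dist_def)
  have "L2_set y K \<le> L2_set (\<lambda>k. y k - x k) K + L2_set x K"
    using L2_set_triangle_ineq[of "\<lambda>k. y k - x k" x K] by simp
  moreover have "L2_set x K \<le> L2_set (\<lambda>k. x k - y k) K + L2_set y K"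
    using L2_set_triangle_ineq[of "\<lambda>k. x k - y k" y K] by simp
  moreover have "L2_set (\<lambda>k. x k - y k) K = L2_set (\<lambda>k. y k - x k) K"
    by (simp add: L2_set_def power2_commute)
  ultimately show ?thesis using d by linarith
qed

lemma sqrt_prod: "sqrt (\<Prod>k\<in>K. f k) = (\<Prod>k\<in>K. sqrt (f k))"
  by (induction K rule: infinite_finite_induct) (simp_all add: real_sqrt_mult)

text \<open>Summable variances put all mass on \<open>l2\<close>, so the extension by 0 changes the
  function only on a null set.\<close>

lemma integral_ext_H_exp:
  assumes "\<And>k. 0 \<le> v k" "summable v" "0 \<le> a" "finite K"
  shows "(\<integral>x. ext_H (\<lambda>x. c * exp (- a * (\<Sum>k\<in>K. (x k)\<^sup>2))) x \<partial>diag_gauss v)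
    = c / sqrt (\<Prod>k\<in>K. 1 + 2 * a * v k)"
proof -
  let ?\<phi> = "\<lambda>x. c * exp (- a * (\<Sum>k\<in>K. (x k)\<^sup>2))"
  have "(\<integral>x. ext_H ?\<phi> x \<partial>diag_gauss v) = (\<integral>x. ?\<phi> x \<partial>diag_gauss v)"
  proof (rule integral_cong_AE)
    show "ext_H ?\<phi> \<in> borel_measurable (diag_gauss v)"
      unfolding ext_H_def by measurable
    show "?\<phi> \<in> borel_measurable (diag_gauss v)"
      by measurable
    show "AE x in diag_gauss v. ext_H ?\<phi> x = ?\<phi> x"
      using AE_diag_gauss_l2[OF assms(1,2)] by eventually_elim (simp add: ext_H_def)
  qed
  also have "\<dots> = c * (\<Prod>k\<in>K. 1 / sqrt (1 + 2 * a * v k))"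
    using integral_diag_gauss_exp[OF assms(1,3,4)] by simp
  also have "\<dots> = c / sqrt (\<Prod>k\<in>K. 1 + 2 * a * v k)"
    by (simp add: prod_dividef sqrt_prod)
  finally show ?thesis .
qed

text \<open>With variances of order \<open>1 / n\<^sup>2\<close> and exponent weight
  \<open>n\<close>, a single mode changes the expectation by a factor \<open>1 + O(1 / n)\<close>,
  hence \<open>n\<close> modes together change it by a fixed factor. \<open>K_upper\<close> keeps
  the expectations away from 0, \<open>K_gap\<close> keeps their ratio away from 1, and the loss
  \<open>1 / sqrt n\<close> comes from normalizing the Lipschitz constant.\<close>

lemma BL_dist_ge_block:
  fixes C c :: real and n :: nat
  assumes v: "\<And>k. 0 \<le> v k" "summable v" and w: "\<And>k. 0 \<le> w k" "summable w"
    and n: "0 < n" and K: "finite K" "card K = n" and c: "0 \<le> c"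
    and K_upper: "\<And>k. k \<in> K \<Longrightarrow> v k \<le> C / (real n)\<^sup>2"
    and K_gap: "\<And>k. k \<in> K \<Longrightarrow> c / (real n)\<^sup>2 \<le> v k - w k"
  shows "exp (- C) * (sqrt (1 + 2 * c / (1 + 2 * C)) - 1) / (2 * sqrt n)
    \<le> BL_dist (diag_gauss v) (diag_gauss w)"
proof -
  \<comment> \<open>Chosen so that each ratio \<open>b k / d k\<close> is at least
    \<open>1 + h / n\<close>: its numerator exceeds \<open>d k\<close> by at least
    \<open>2 * c / n\<close>, and \<open>d k \<le> 1 + 2 * C\<close>.\<close>
  define h where "h = 2 * c / (1 + 2 * C)"
  define b where "b k = 1 + 2 * real n * v k" for k
  define d where "d k = 1 + 2 * real n * w k" for k
  define \<phi> :: "(nat \<Rightarrow> real) \<Rightarrow> real"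
    where "\<phi> x = 1 / (2 * sqrt n) * exp (- real n * (\<Sum>k\<in>K. (x k)\<^sup>2))" for x
  have sqrt_n: "1 \<le> sqrt n" using n by simp
  obtain k0 where "k0 \<in> K" using K n by fastforce
  then have "0 \<le> C / (real n)\<^sup>2" using K_upper v(1) order_trans by blast
  then have C: "0 \<le> C" using n by (simp add: zero_le_divide_iff)
  have h: "0 \<le> h" using C c by (simp add: h_def)
  have b: "1 \<le> b k" and d: "1 \<le> d k" for k
    using v w by (simp_all add: b_def d_def)

  have \<phi>: "\<phi> \<in> BL" "BL_norm \<phi> \<le> 1"
  proof -
    have sup: "\<bar>\<phi> x\<bar> \<le> 1 / 2" for x
    proof -
      have "exp (- real n * (\<Sum>k\<in>K. (x k)\<^sup>2)) \<le> 1"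
        by (simp add: sum_nonneg)
      also have "1 \<le> sqrt n" by (rule sqrt_n)
      finally show ?thesis
        using n by (simp add: \<phi>_def field_simps)
    qed
    have lip: "\<bar>\<phi> y - \<phi> x\<bar> \<le> 1 / 2 * l2_dist x y" if "x \<in> l2" "y \<in> l2" for x y
    proof -
      \<comment> \<open>As a function of the block norm, the exponential is a rescaled
        \<open>exp (- t\<^sup>2)\<close> with Lipschitz constant at most \<open>sqrt n\<close>; the
        prefactor reduces it to \<open>1 / 2\<close>.\<close>
      have \<phi>_eq: "\<phi> z = 1 / (2 * sqrt n) * exp (- (sqrt n * L2_set z K)\<^sup>2)" for z
        by (simp add: \<phi>_def L2_set_def power_mult_distrib sum_nonneg)
      have "\<bar>\<phi> y - \<phi> x\<bar> = 1 / (2 * sqrt n)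
          * \<bar>exp (- (sqrt n * L2_set y K)\<^sup>2) - exp (- (sqrt n * L2_set x K)\<^sup>2)\<bar>"
        unfolding \<phi>_eq by (simp add: abs_mult flip: right_diff_distrib diff_divide_distrib)
      also have "\<dots> \<le> 1 / (2 * sqrt n) * \<bar>sqrt n * L2_set y K - sqrt n * L2_set x K\<bar>"
        by (intro mult_left_mono exp_neg_square_lipschitz) auto
      also have "\<dots> = 1 / 2 * \<bar>L2_set y K - L2_set x K\<bar>"
        using n by (simp add: abs_mult flip: right_diff_distrib)
      also have "\<dots> \<le> 1 / 2 * l2_dist x y"
        using L2_set_diff_le_l2_dist[OF K(1) that] by simp
      finally show ?thesis .
    qed
    show "\<phi> \<in> BL" "BL_norm \<phi> \<le> 1"
      using BL_normI[OF sup lip] by simp_all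
  qed

  have "(\<Prod>k\<in>K. b k) \<le> (\<Prod>k\<in>K. 1 + 2 * C / n)"
  proof (rule prod_mono)
    fix k assume "k \<in> K"
    then have "2 * real n * v k \<le> 2 * real n * (C / (real n)\<^sup>2)"
      by (intro mult_left_mono K_upper) auto
    then show "0 \<le> b k \<and> b k \<le> 1 + 2 * C / n"
      using n b[of k] by (simp add: b_def power2_eq_square)
  qed
  also have "\<dots> = (1 + 2 * C / n) ^ n"
    using K by simp
  also have "\<dots> \<le> exp (2 * C)"
    using exp_ge_one_plus_x_over_n_power_n[of n "2 * C"] n C by simp
  finally have "sqrt (\<Prod>k\<in>K. b k) \<le> sqrt (exp (2 * C))"
    by simp
  also have "\<dots> = exp C"
    by (rule real_sqrt_unique) (simp_all flip: exp_double)
  finally have upper: "sqrt (\<Prod>k\<in>K. b k) \<le> exp C" .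

  \<comment> \<open>Bernoulli's inequality turns the gain of each mode into a gain that does not
    depend on \<open>n\<close>.\<close>
  have "1 + h \<le> (1 + h / n) ^ n"
    using Bernoulli_inequality[of "h / n" n] n h by (simp add: order_trans[of "- 1" 0])
  also have "\<dots> = (\<Prod>k\<in>K. 1 + h / n)"
    using K by simp
  also have "\<dots> \<le> (\<Prod>k\<in>K. b k / d k)"
  proof (rule prod_mono)
    fix k assume k: "k \<in> K"
    have "0 \<le> c / (real n)\<^sup>2" using c by simp
    then have "w k \<le> v k" using K_gap[OF k] by linarith
    then have "2 * real n * w k \<le> 2 * real n * (C / (real n)\<^sup>2)"
      using K_upper[OF k] by (intro mult_left_mono) auto
    also have "\<dots> = 2 * C / n"
      using n by (simp add: power2_eq_square)
    also have "\<dots> \<le> 2 * C"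
      using n C by (simp add: divide_le_eq mult_le_cancel_left1)
    finally have "d k \<le> 1 + 2 * C" by (simp add: d_def)
    moreover have "2 * real n * (c / (real n)\<^sup>2) \<le> 2 * real n * (v k - w k)"
      by (intro mult_left_mono K_gap[OF k]) auto
    then have "2 * c / n \<le> b k - d k"
      using n by (simp add: b_def d_def power2_eq_square algebra_simps)
    moreover have "0 \<le> 2 * c / n" using c by simp
    ultimately have "(2 * c / n) / (1 + 2 * C) \<le> (b k - d k) / d k"
      using d[of k] by (intro frac_le) linarith+
    moreover have "0 \<le> h / n" using h by simp
    ultimately show "0 \<le> 1 + h / n \<and> 1 + h / n \<le> b k / d k"
      using h d[of k] by (simp add: h_def diff_divide_distrib mult.commute)
  qed
  also have "\<dots> = (\<Prod>k\<in>K. b k) / (\<Prod>k\<in>K. d k)"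
    by (rule prod_dividef)
  finally have ratio: "sqrt (1 + h) \<le> sqrt (\<Prod>k\<in>K. b k) / sqrt (\<Prod>k\<in>K. d k)"
    by (simp flip: real_sqrt_divide)

  have prod_pos: "0 < (\<Prod>k\<in>K. b k)" "0 < (\<Prod>k\<in>K. d k)"
    using b d by (auto intro!: prod_pos intro: less_le_trans[of 0 1])
  have "exp (- C) * (sqrt (1 + h) - 1) \<le> 1 / sqrt (\<Prod>k\<in>K. b k) * (sqrt (1 + h) - 1)"
    using upper prod_pos h by (intro mult_right_mono) (auto simp: exp_minus field_simps)
  also have "\<dots> \<le> 1 / sqrt (\<Prod>k\<in>K. b k)
      * (sqrt (\<Prod>k\<in>K. b k) / sqrt (\<Prod>k\<in>K. d k) - 1)"
    using ratio prod_pos by (intro mult_left_mono) auto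
  also have "\<dots> = 1 / sqrt (\<Prod>k\<in>K. d k) - 1 / sqrt (\<Prod>k\<in>K. b k)"
    using prod_pos by (simp add: field_simps)
  finally have "1 / (2 * sqrt n) * (exp (- C) * (sqrt (1 + h) - 1))
      \<le> 1 / (2 * sqrt n) * (1 / sqrt (\<Prod>k\<in>K. d k) - 1 / sqrt (\<Prod>k\<in>K. b k))"
    by (intro mult_left_mono) auto
  \<comment> \<open>The order is reversed: the smaller variances \<open>w\<close> give the larger
    expectation.\<close>
  also have "\<dots> = (\<integral>x. ext_H \<phi> x \<partial>diag_gauss w) - (\<integral>x. ext_H \<phi> x \<partial>diag_gauss v)"
    unfolding \<phi>_def using v w K by (simp only: integral_ext_H_exp of_nat_0_le_iff b_def d_def)
      (simp add: right_diff_distrib)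
  also have "\<dots> \<le> BL_dist (diag_gauss v) (diag_gauss w)"
    using BL_dist_ge[OF v w, of \<phi>] \<phi> by simp
  finally show ?thesis by (simp add: h_def)
qed

section \<open>Variances of the stochastic heat equation and its discretizations\<close>

lemma lam_powr: "lam n powr p = (pi\<^sup>2) powr p * real n powr (2 * p)"
proof -
  have "(real n)\<^sup>2 = real n powr 2" by simp
  then show ?thesis unfolding lam_def powr_mult by (simp only: powr_powr)
qed

lemma lam_Suc_ge: "4 * (real (Suc k))\<^sup>2 \<le> lam (Suc k)"
proof -
  have "2\<^sup>2 \<le> pi\<^sup>2" using pi_ge_two by (intro power_mono) auto
  then show ?thesis unfolding lam_def by (intro mult_right_mono) auto
qed

lemma lam_Suc_ge_1: "1 \<le> lam (Suc k)"
proof -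
  have "1 \<le> (real (Suc k))\<^sup>2" by simp
  then show ?thesis using lam_Suc_ge[of k] by linarith
qed

lemma lam_le: "lam n \<le> 16 * (real n)\<^sup>2"
proof -
  have "pi\<^sup>2 \<le> 4\<^sup>2" using pi_less_4 by (intro power_mono) auto
  then show ?thesis unfolding lam_def by (intro mult_right_mono) auto
qed

lemma lam_mono: "m \<le> n \<Longrightarrow> lam m \<le> lam n"
  unfolding lam_def by (intro mult_left_mono power_mono) auto

text \<open>Since \<open>lam\<close> grows quadratically, the threshold is \<open>- 1 / 2\<close>.
  Applied with \<open>p = \<theta> - 1\<close>, it requires \<open>\<theta> < 1 / 2\<close>, which
  is the source of the critical rate \<open>1 / 4\<close>.\<close>

lemma summable_lam_powr:
  assumes "p < - 1 / 2"
  shows "summable (\<lambda>k. lam (Suc k) powr p)"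
proof -
  have "summable (\<lambda>n. real n powr (2 * p))"
    using assms by (simp add: summable_real_powr_iff)
  then have "summable (\<lambda>k. real (Suc k) powr (2 * p))"
    by (subst summable_Suc_iff)
  then show ?thesis unfolding lam_powr by (rule summable_mult)
qed

section \<open>Variances of the exact solution and general distance bounds\<close>

definition heat_var :: "real \<Rightarrow> nat \<Rightarrow> real" where
  "heat_var T k = (1 - exp (- 2 * lam (Suc k) * T)) / (2 * lam (Suc k))"

lemma mu_eq: "mu T = diag_gauss (heat_var T)"
  by (simp add: mu_def heat_var_def[abs_def])

lemma heat_var_nonneg: "0 \<le> T \<Longrightarrow> 0 \<le> heat_var T k"
  using lam_Suc_ge_1[of k] by (simp add: heat_var_def)

lemma heat_var_le: "heat_var T k \<le> 1 / (2 * lam (Suc k))"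
  using lam_Suc_ge_1[of k] by (simp add: heat_var_def divide_right_mono)

text \<open>From \<open>u = 2 * lam (Suc k) * T \<ge> 2\<close> follows
  \<open>exp u \<ge> 1 + u \<ge> 3\<close>, so at least two thirds of the stationary variance have
  been reached.\<close>

lemma heat_var_ge:
  assumes "1 \<le> lam (Suc k) * T"
  shows "1 / (3 * lam (Suc k)) \<le> heat_var T k"
proof -
  define u where "u = 2 * lam (Suc k) * T"
  have u: "2 \<le> u" using assms by (simp add: u_def)
  then have "3 \<le> exp u"
    using exp_ge_add_one_self[of u] by linarith
  then have "exp (- u) \<le> 1 / 3"
    by (simp add: exp_minus field_simps)
  then have "2 / 3 \<le> 1 - exp (- u)" by simp
  then have "(2 / 3) / (2 * lam (Suc k)) \<le> (1 - exp (- u)) / (2 * lam (Suc k))"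
    using lam_Suc_ge_1[of k] by (intro divide_right_mono) auto
  then show ?thesis by (simp add: heat_var_def u_def)
qed

lemma summable_heat_var:
  assumes "0 \<le> T"
  shows "summable (heat_var T)"
proof (rule summable_comparison_test')
  show "summable (\<lambda>k. lam (Suc k) powr (- 1))"
    by (rule summable_lam_powr) simp
  show "norm (heat_var T k) \<le> lam (Suc k) powr (- 1)" if "k \<ge> 0" for k
    using heat_var_le[of T k] heat_var_nonneg[OF assms, of k] lam_Suc_ge_1[of k]
    by (simp add: powr_minus field_simps)
qed

text \<open>Summing the modewise errors gives order \<open>\<epsilon> powr \<theta>\<close>, and the
  square root in the coupling bound halves the exponent.\<close>

lemma BL_dist_mu_le:
  assumes T: "0 \<le> T" and w: "\<And>k. 0 \<le> w k" "\<And>k. w k \<le> heat_var T k"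
    and \<theta>: "\<theta> < 1 / 2" and \<epsilon>: "0 < \<epsilon>" and C: "0 \<le> C"
    and diff: "\<And>k. heat_var T k - w k \<le> C * \<epsilon> powr \<theta> * lam (Suc k) powr (\<theta> - 1)"
  shows "BL_dist (mu T) (diag_gauss w)
    \<le> sqrt (C * (\<Sum>k. lam (Suc k) powr (\<theta> - 1)) + 1) * \<epsilon> powr (\<theta> / 2)"
proof -
  let ?S = "\<Sum>k. lam (Suc k) powr (\<theta> - 1)"
  have sum: "summable (\<lambda>k. lam (Suc k) powr (\<theta> - 1))"
    by (rule summable_lam_powr) (use \<theta> in simp)
  have S: "0 \<le> ?S" by (intro suminf_nonneg sum) simp
  have w_sum: "summable w"
    by (rule summable_comparison_test'[OF summable_heat_var[OF T]]) (use w in auto)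
  have sum_C: "summable (\<lambda>k. C * \<epsilon> powr \<theta> * lam (Suc k) powr (\<theta> - 1))"
    by (intro summable_mult sum)
  have "(\<Sum>k. \<bar>heat_var T k - w k\<bar>) \<le> (\<Sum>k. C * \<epsilon> powr \<theta> * lam (Suc k) powr (\<theta> - 1))"
  proof (rule suminf_le)
    show "\<bar>heat_var T k - w k\<bar> \<le> C * \<epsilon> powr \<theta> * lam (Suc k) powr (\<theta> - 1)" for k
      using diff[of k] w(2)[of k] by simp
    then show "summable (\<lambda>k. \<bar>heat_var T k - w k\<bar>)"
      by (intro summable_comparison_test'[OF sum_C]) auto
  qed (rule sum_C)
  also have "\<dots> = C * ?S * \<epsilon> powr \<theta>"
    using suminf_mult[OF sum, of "C * \<epsilon> powr \<theta>"] by (simp add: mult_ac)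
  \<comment> \<open>The added 1 makes the bound strictly positive, as \<open>BL_dist_le\<close>
    demands.\<close>
  also have "\<dots> \<le> (C * ?S + 1) * \<epsilon> powr \<theta>"
    by (intro mult_right_mono) auto
  also have "\<dots> = (sqrt (C * ?S + 1) * \<epsilon> powr (\<theta> / 2))\<^sup>2"
    using C S by (simp add: power_mult_distrib power2_eq_square[of "\<epsilon> powr _"] flip: powr_add)
  finally show ?thesis
    unfolding mu_eq using T w \<epsilon> C S w_sum
    by (intro BL_dist_le heat_var_nonneg summable_heat_var)
       (auto intro!: mult_pos_pos add_nonneg_pos)
qed

text \<open>\<open>BL_dist_ge_block\<close> with \<open>C = 1\<close> and \<open>c = 1 / 384\<close>: on the block \<open>lam \<le> 64 * N\<^sup>2\<close>, and the
  variance gap is at least \<open>1 / (3 * lam) - 1 / (6 * lam)\<close>.\<close>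

definition block_const :: real where
  "block_const = exp (- 1) * (sqrt (1 + 2 * (1 / 384) / (1 + 2 * 1)) - 1) / 2"

lemma block_const_pos: "0 < block_const"
  by (simp add: block_const_def)

lemma BL_dist_mu_ge:
  assumes N: "0 < N" "1 \<le> (real N)\<^sup>2 * T" and T: "0 \<le> T"
    and w: "\<And>k. 0 \<le> w k" "summable w"
    and small: "\<And>k. N \<le> k \<Longrightarrow> w k \<le> 1 / (6 * lam (Suc k))"
  shows "block_const / sqrt N \<le> BL_dist (mu T) (diag_gauss w)"
proof -
  have "exp (- 1) * (sqrt (1 + 2 * (1 / 384) / (1 + 2 * 1)) - 1) / (2 * sqrt N)
      \<le> BL_dist (diag_gauss (heat_var T)) (diag_gauss w)"
  proof (rule BL_dist_ge_block[where K="{N..<2 * N}"])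
    \<comment> \<open>Index \<open>k\<close> stands for mode \<open>k + 1\<close>, so the block
      consists of the modes \<open>N + 1\<close> to \<open>2 * N\<close>; the first of them is the
      first mode that the Galerkin projection discards.\<close>
    fix k assume k: "k \<in> {N..<2 * N}"
    have N2: "(real N)\<^sup>2 \<le> (real (Suc k))\<^sup>2" using k by (intro power_mono) auto
    then have lam_ge: "(real N)\<^sup>2 \<le> lam (Suc k)"
      using lam_Suc_ge[of k] zero_le_power2[of "real N"] by linarith
    have "1 / (2 * lam (Suc k)) \<le> 1 / (real N)\<^sup>2"
      using N lam_ge lam_Suc_ge_1[of k] by (intro divide_left_mono mult_pos_pos) auto
    then show "heat_var T k \<le> 1 / (real N)\<^sup>2"
      using heat_var_le[of T k] by linarith
    have "(real (Suc k))\<^sup>2 \<le> (2 * real N)\<^sup>2" using k by (intro power_mono) auto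
    then have lam_le: "lam (Suc k) \<le> 64 * (real N)\<^sup>2"
      using lam_le[of "Suc k"] by (simp add: power_mult_distrib)
    have "(real N)\<^sup>2 * T \<le> lam (Suc k) * T"
      using lam_ge T by (rule mult_right_mono)
    then have "1 / (3 * lam (Suc k)) \<le> heat_var T k"
      using N by (intro heat_var_ge) linarith
    then have "1 / (6 * lam (Suc k)) \<le> heat_var T k - w k"
      using small[of k] k lam_Suc_ge_1[of k] by (simp add: field_simps)
    \<comment> \<open>Here \<open>384 = 6 * 64\<close>, from
      \<open>lam (Suc k) \<le> 64 * (real N)\<^sup>2\<close>.\<close>
    moreover have "1 / 384 / (real N)\<^sup>2 \<le> 1 / (6 * lam (Suc k))"
      using N lam_le lam_Suc_ge_1[of k] by (simp add: field_simps)
    ultimately show "1 / 384 / (real N)\<^sup>2 \<le> heat_var T k - w k" by linarith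
  qed (use T w N in \<open>auto intro: heat_var_nonneg summable_heat_var\<close>)
  then show ?thesis by (simp add: mu_eq block_const_def)
qed

text \<open>Split \<open>x\<close> into its powers \<open>\<theta>\<close> and
  \<open>1 - \<theta>\<close> and bound each by a different estimate. Below, this trades smallness
  in the discretization parameter against decay in the mode.\<close>

lemma powr_interpolation_bound:
  fixes x a b \<theta> :: real
  assumes "0 \<le> x" "x \<le> a" "x \<le> b" "0 \<le> \<theta>" "\<theta> \<le> 1"
  shows "x \<le> a powr \<theta> * b powr (1 - \<theta>)"
proof -
  have "x = x powr \<theta> * x powr (1 - \<theta>)"
    using assms by (cases "x = 0") (simp_all flip: powr_add)
  also have "\<dots> \<le> a powr \<theta> * b powr (1 - \<theta>)"
    using assms by (intro mult_mono powr_mono2) auto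
  finally show ?thesis .
qed

section \<open>Variances of the Galerkin projection\<close>

definition galerkin_var :: "real \<Rightarrow> nat \<Rightarrow> nat \<Rightarrow> real" where
  "galerkin_var T N k = (if Suc k \<le> N then heat_var T k else 0)"

lemma mu_gal_eq: "mu_gal T N = diag_gauss (galerkin_var T N)"
  by (simp add: mu_gal_def galerkin_var_def[abs_def] heat_var_def cong: if_cong)

lemma galerkin_var_bounds:
  assumes "0 \<le> T"
  shows "0 \<le> galerkin_var T N k" "galerkin_var T N k \<le> heat_var T k"
  using heat_var_nonneg[OF assms] by (auto simp: galerkin_var_def)

text \<open>Only discarded modes contribute. Their whole variance is lost, and it is at most
  \<open>1 / lam (Suc k)\<close> and therefore at most \<open>1 / lam N\<close>; these two bounds
  are interpolated.\<close>

lemma galerkin_var_diff_le: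
  assumes "0 \<le> T" "0 < N" "0 \<le> \<theta>" "\<theta> \<le> 1"
  shows "heat_var T k - galerkin_var T N k \<le> 1 * (1 / lam N) powr \<theta> * lam (Suc k) powr (\<theta> - 1)"
proof (cases "Suc k \<le> N")
  case False
  have lam_N: "1 \<le> lam N" using lam_Suc_ge_1[of "N - 1"] assms by simp
  have le: "heat_var T k \<le> 1 / lam (Suc k)"
    using heat_var_le[of T k] lam_Suc_ge_1[of k] by (simp add: field_simps)
  also have "\<dots> \<le> 1 / lam N"
    using False lam_N lam_Suc_ge_1[of k] by (intro divide_left_mono lam_mono mult_pos_pos) auto
  finally have "heat_var T k \<le> (1 / lam N) powr \<theta> * (1 / lam (Suc k)) powr (1 - \<theta>)"
    using le heat_var_nonneg assms by (intro powr_interpolation_bound)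
  also have "(1 / lam (Suc k)) powr (1 - \<theta>) = lam (Suc k) powr (\<theta> - 1)"
    using lam_Suc_ge_1[of k] by (simp add: powr_divide powr_diff)
  finally show ?thesis using False by (simp add: galerkin_var_def)
qed (simp add: galerkin_var_def)

section \<open>Variances of the linear implicit Euler scheme\<close>

definition euler_var :: "real \<Rightarrow> nat \<Rightarrow> nat \<Rightarrow> real" where
  "euler_var dt m k = dt * (\<Sum>l<m. (1 / (1 + dt * lam (Suc k))) ^ (2 * (m - l)))"

lemma nu_eq: "nu dt m = diag_gauss (euler_var dt m)"
  by (simp add: nu_def euler_var_def[abs_def])

text \<open>A geometric sum in \<open>q\<^sup>2\<close>, where \<open>q = 1 / (1 + dt * L)\<close>.
  As \<open>1 - q\<^sup>2 = q\<^sup>2 * (dt * L * (2 + dt * L))\<close>, the factors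
  \<open>q\<^sup>2\<close> and \<open>dt\<close> cancel.\<close>

lemma euler_var_closed:
  assumes "0 < dt"
  shows "euler_var dt m k = (1 - (1 / (1 + dt * lam (Suc k))) ^ (2 * m))
    / (lam (Suc k) * (2 + dt * lam (Suc k)))"
proof -
  define L where "L = lam (Suc k)"
  define q where "q = 1 / (1 + dt * L)"
  have L: "0 < L" using lam_Suc_ge_1[of k] by (simp add: L_def)
  then have x: "0 < dt * L" using assms by simp
  have "(\<Sum>l<m. q ^ (2 * (m - l))) * (1 - q\<^sup>2) = q\<^sup>2 * (1 - q ^ (2 * m))"
  proof -
    \<comment> \<open>Summation in reverse order: \<open>m - l\<close> runs through
      \<open>1, ..., m\<close>, never through 0.\<close>
    have "(\<Sum>l<m. q ^ (2 * (m - l))) = (\<Sum>l<m. q ^ (2 * Suc l))"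
      by (subst sum.nat_diff_reindex[symmetric]) (auto intro!: sum.cong)
    also have "\<dots> = q\<^sup>2 * (\<Sum>l<m. (q\<^sup>2) ^ l)"
      unfolding sum_distrib_left by (metis (no_types) mult_Suc_right power_add power_mult)
    finally have sum_eq: "(\<Sum>l<m. q ^ (2 * (m - l))) = q\<^sup>2 * (\<Sum>l<m. (q\<^sup>2) ^ l)" .
    have "1 - q ^ (2 * m) = (1 - q\<^sup>2) * (\<Sum>l<m. (q\<^sup>2) ^ l)"
      using one_diff_power_eq[of "q\<^sup>2" m] by (simp add: power_mult)
    then show ?thesis
      unfolding sum_eq by (metis mult.assoc mult.commute)
  qed
  moreover have "(1 - q\<^sup>2) = q\<^sup>2 * (dt * L * (2 + dt * L))"
  proof -
    have "1 = q * (1 + dt * L)" using x by (simp add: q_def)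
    then have "1 = q\<^sup>2 * (1 + dt * L)\<^sup>2" by (metis power_mult_distrib power_one)
    then show ?thesis by (simp add: power2_eq_square algebra_simps)
  qed
  moreover have "q \<noteq> 0" using x by (simp add: q_def)
  ultimately have "(\<Sum>l<m. q ^ (2 * (m - l))) * (dt * L * (2 + dt * L)) = 1 - q ^ (2 * m)"
    by simp
  then have "dt * (\<Sum>l<m. q ^ (2 * (m - l))) = (1 - q ^ (2 * m)) / (L * (2 + dt * L))"
    using x L by (simp add: eq_divide_eq mult_ac)
  then show ?thesis by (simp add: euler_var_def q_def L_def)
qed

lemma euler_var_nonneg: "0 < dt \<Longrightarrow> 0 \<le> euler_var dt m k"
  using lam_Suc_ge_1[of k]
  by (auto simp: euler_var_def intro!: mult_nonneg_nonneg sum_nonneg zero_le_power divide_nonneg_nonneg add_nonneg_nonneg)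

text \<open>The right-hand side is the stationary variance of the scheme, of which the closed form
  is a fraction.\<close>

lemma euler_var_le:
  assumes "0 < dt"
  shows "euler_var dt m k \<le> 1 / (lam (Suc k) * (2 + dt * lam (Suc k)))"
  unfolding euler_var_closed[OF assms] using lam_Suc_ge_1[of k] assms
  by (intro divide_right_mono) (auto intro!: zero_le_power divide_nonneg_nonneg add_nonneg_nonneg mult_nonneg_nonneg)

lemma exp_neg_diff_le:
  fixes y z :: real
  assumes "0 \<le> y" "y \<le> z"
  shows "exp (- y) - exp (- z) \<le> z - y"
proof -
  have "exp (- y) - exp (- z) = exp (- y) * (1 - exp (- (z - y)))"
    by (simp add: right_diff_distrib flip: exp_add)
  also have "\<dots> \<le> 1 * (z - y)"
  proof (rule mult_mono)
    show "1 - exp (- (z - y)) \<le> z - y"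
      using exp_ge_add_one_self[of "- (z - y)"] by linarith
  qed (use assms in auto)
  finally show ?thesis by simp
qed

text \<open>The error splits into \<open>A\<close>, from the stationary variances, and
  \<open>B\<close>, from the transient factors \<open>Q\<close> of the scheme and \<open>E\<close>
  of the exact solution. Both are nonnegative, which gives the ordering; each is then interpolated
  between a bound that is linear in \<open>dt\<close> and a bound that decays in
  \<open>L\<close>.\<close>

lemma euler_var_diff:
  assumes dt: "0 < dt" "dt \<le> T / 2" and m: "m = nat \<lfloor>T / dt\<rfloor>" and \<theta>: "0 \<le> \<theta>" "\<theta> < 1 / 2"
  shows "euler_var dt m k \<le> heat_var T k"
    and "heat_var T k - euler_var dt m k
      \<le> (1 + (1 + T) powr \<theta> * (1 / T) powr (1 - \<theta>)) * dt powr \<theta> * lam (Suc k) powr (\<theta> - 1)"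
proof -
  define L where "L = lam (Suc k)"
  define x where "x = dt * L"
  define Q where "Q = (1 / (1 + x)) ^ (2 * m)"
  define E where "E = exp (- 2 * L * T)"
  define A where "A = (1 - Q) * (x / (2 * L * (2 + x)))"
  define B where "B = (Q - E) / (2 * L)"
  have L: "1 \<le> L" using lam_Suc_ge_1[of k] by (simp add: L_def)
  have T: "0 < T" using dt by simp
  have x: "0 < x" using dt L by (simp add: x_def)
  have m_real: "real m = of_int \<lfloor>T / dt\<rfloor>" using m T dt by simp
  have m_le: "real m * dt \<le> T"
    using of_int_floor_le[of "T / dt"] dt unfolding m_real by (simp add: le_divide_eq)
  have m_gt: "T - dt \<le> real m * dt"
  proof -
    have "T / dt < real m + 1" unfolding m_real by linarith
    then show ?thesis using dt by (simp add: divide_less_eq algebra_simps)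
  qed

  have diff: "heat_var T k - euler_var dt m k = A + B"
  proof -
    have "heat_var T k = (1 - E) / (2 * L)" by (simp add: heat_var_def E_def L_def)
    moreover have "euler_var dt m k = (1 - Q) / (L * (2 + x))"
      by (simp add: euler_var_closed[OF dt(1)] Q_def x_def L_def)
    moreover have "x / (2 * L * (2 + x)) = 1 / (2 * L) - 1 / (L * (2 + x))"
      using L x by (simp add: divide_simps)
    then have "A = (1 - Q) / (2 * L) - (1 - Q) / (L * (2 + x))"
      by (simp add: A_def right_diff_distrib)
    ultimately show ?thesis by (simp add: B_def diff_divide_distrib)
  qed

  have Q_exp: "Q = exp (- (2 * m * ln (1 + x)))"
  proof -
    have "1 / (1 + x) = exp (- ln (1 + x))" using x by (simp add: exp_minus field_simps)
    then show ?thesis by (simp add: Q_def flip: exp_of_nat_mult)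
  qed
  have mx_le: "2 * m * x \<le> 2 * L * T"
    using mult_right_mono[OF m_le, of L] L by (simp add: x_def mult_ac)
  \<comment> \<open>The resolvent damps less than the semigroup, since
    \<open>ln (1 + x) \<le> x\<close>, and the discrete time \<open>m * dt\<close> does not exceed
    \<open>T\<close>; hence \<open>E \<le> Q\<close>.\<close>
  have log_le: "2 * m * ln (1 + x) \<le> 2 * L * T"
  proof -
    have "2 * m * ln (1 + x) \<le> 2 * m * x"
      using ln_add_one_self_le_self[of x] x by (intro mult_left_mono) auto
    then show ?thesis using mx_le by linarith
  qed
  have E_le_Q: "E \<le> Q" using log_le by (simp add: E_def Q_exp)
  have Q_nonneg: "0 \<le> Q" and Q_le_1: "Q \<le> 1"
    using x by (simp_all add: Q_exp)
  have A_nonneg: "0 \<le> A" using Q_le_1 L x by (simp add: A_def)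
  have B_nonneg: "0 \<le> B" using E_le_Q L by (simp add: B_def)
  show "euler_var dt m k \<le> heat_var T k" using diff A_nonneg B_nonneg by linarith

  have A_le: "A \<le> x / (2 * L * (2 + x))"
    unfolding A_def using Q_nonneg L x by (intro mult_left_le_one_le) (auto simp: Q_le_1)
  have "x / (2 * L * (2 + x)) \<le> x / L"
  proof (rule divide_left_mono)
    show "L \<le> 2 * L * (2 + x)"
      using L x mult_left_mono[of 1 "2 * (2 + x)" L] by (simp add: mult_ac)
  qed (use L x in auto)
  then have A_le_dt: "A \<le> dt" using A_le L by (simp add: x_def)
  have "x / (2 * L * (2 + x)) \<le> 1 / L"
    using L x by (simp add: divide_simps)
  then have A_le_L: "A \<le> L powr - 1" using A_le L by (simp add: powr_minus_divide)
  have "(L powr - 1) powr (1 - \<theta>) = L powr (\<theta> - 1)"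
    unfolding powr_powr by simp
  then have A_bound: "A \<le> dt powr \<theta> * L powr (\<theta> - 1)"
    using powr_interpolation_bound[OF A_nonneg A_le_dt A_le_L, of \<theta>] \<theta> by simp

  have "Q - E \<le> 2 * L * T - 2 * m * ln (1 + x)"
    using exp_neg_diff_le[OF _ log_le] x by (simp add: Q_exp E_def)
  also have "\<dots> \<le> 2 * L * T - 2 * m * (x - x\<^sup>2)"
  proof -
    have "x - x\<^sup>2 \<le> ln (1 + x)"
    proof (cases "x \<le> 1")
      case True
      then show ?thesis using ln_one_plus_pos_lower_bound[of x] x by simp
    next
      case False
      then have "x * 1 \<le> x * x" by (intro mult_left_mono) auto
      moreover have "0 \<le> ln (1 + x)" using x by simp
      ultimately show ?thesis unfolding power2_eq_square by linarith
    qed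
    then have "2 * m * (x - x\<^sup>2) \<le> 2 * m * ln (1 + x)" by (intro mult_left_mono) auto
    then show ?thesis by linarith
  qed
  \<comment> \<open>Two sources of error: the time lost by rounding \<open>T / dt\<close> down, and
    the quadratic remainder of the logarithm.\<close>
  also have "\<dots> = 2 * L * (T - m * dt) + 2 * (m * dt) * L * x"
    by (simp add: x_def power2_eq_square algebra_simps)
  also have "\<dots> \<le> 2 * L * dt + 2 * T * L * x"
    using m_gt m_le L x by (intro add_mono mult_left_mono mult_right_mono) auto
  also have "\<dots> \<le> (2 * L) * ((1 + T) * (dt * L))"
  proof -
    have "2 * L * dt * 1 \<le> 2 * L * dt * L"
      using L dt by (intro mult_left_mono) auto
    then show ?thesis by (simp add: x_def algebra_simps)
  qed
  finally have B_le_dt: "B \<le> (1 + T) * (dt * L)"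
    using L by (simp add: B_def divide_le_eq mult_ac)
  have B_le_L: "B \<le> (1 / T) * L powr - 2"
  proof -
    have "(1 + x) ^ (2 * m) \<ge> 1 + 2 * m * x"
      using Bernoulli_inequality[of x "2 * m"] x by simp
    \<comment> \<open>The assumption \<open>dt \<le> T / 2\<close> enters here: it gives
      \<open>m * dt \<ge> T - dt \<ge> T / 2\<close>.\<close>
    moreover have "L * T \<le> 2 * m * x"
      using mult_right_mono[of T "2 * (real m * dt)" L] m_gt dt L by (simp add: x_def mult_ac)
    ultimately have "L * T \<le> (1 + x) ^ (2 * m)" by linarith
    then have "Q \<le> 1 / (L * T)"
      using L T x unfolding Q_def power_one_over by (intro divide_left_mono) auto
    then have "Q - E \<le> 1 / (L * T)" by (simp add: E_def)
      (smt (verit) exp_gt_zero)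
    then have "B \<le> 1 / (L * T) / (2 * L)"
      unfolding B_def using L by (intro divide_right_mono) auto
    also have "\<dots> \<le> 1 / (L * T) / L"
      using L T by (intro divide_left_mono) auto
    also have "\<dots> = (1 / T) * L powr - 2"
      using L by (simp add: powr_minus_divide powr_numeral power2_eq_square)
    finally show ?thesis .
  qed
  \<comment> \<open>The consistency bound grows like \<open>L\<close>, so the decay of order
    \<open>L powr - 2\<close> is used to compensate. The resulting exponent
    \<open>3 * \<theta> - 2\<close> is at most \<open>\<theta> - 1\<close> because
    \<open>\<theta> < 1 / 2\<close>.\<close>
  have "B \<le> ((1 + T) * (dt * L)) powr \<theta> * ((1 / T) * L powr - 2) powr (1 - \<theta>)"
    using B_nonneg B_le_dt B_le_L \<theta> by (intro powr_interpolation_bound) auto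
  also have "\<dots> = (1 + T) powr \<theta> * (1 / T) powr (1 - \<theta>) * dt powr \<theta>
      * (L powr \<theta> * L powr (- 2 * (1 - \<theta>)))"
    unfolding powr_mult powr_powr by (simp only: mult_ac)
  also have "L powr \<theta> * L powr (- 2 * (1 - \<theta>)) = L powr (\<theta> - 2 * (1 - \<theta>))"
    by (simp flip: powr_add)
  also have "(1 + T) powr \<theta> * (1 / T) powr (1 - \<theta>) * dt powr \<theta> * L powr (\<theta> - 2 * (1 - \<theta>))
      \<le> (1 + T) powr \<theta> * (1 / T) powr (1 - \<theta>) * dt powr \<theta> * L powr (\<theta> - 1)"
    using L \<theta> by (intro mult_left_mono powr_mono) auto
  finally show "heat_var T k - euler_var dt m k
      \<le> (1 + (1 + T) powr \<theta> * (1 / T) powr (1 - \<theta>)) * dt powr \<theta> * lam (Suc k) powr (\<theta> - 1)"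
    using A_bound unfolding diff L_def[symmetric] by (simp add: algebra_simps)
qed

section \<open>Convergence rates\<close>

lemma powr_at_top:
  assumes "0 < (s::real)"
  shows "filterlim (\<lambda>x::real. x powr s) at_top at_top"
  using assms by real_asymp

lemma galerkin_upper:
  assumes T: "0 < T" and r: "0 \<le> r" "r < 1 / 4"
  shows "limsup (\<lambda>N. ereal (lam N powr r * BL_dist (mu T) (mu_gal T N))) = 0"
proof -
  \<comment> \<open>This value lies strictly between \<open>2 * r\<close> and \<open>1 / 2\<close>,
    so the rate \<open>\<theta> / 2\<close> beats \<open>r\<close> while the series over the modes
    still converges.\<close>
  define \<theta> where "\<theta> = r + 1 / 4"
  define K where "K = sqrt (1 * (\<Sum>k. lam (Suc k) powr (\<theta> - 1)) + 1)"
  have \<theta>: "0 \<le> \<theta>" "\<theta> < 1 / 2" using r by (simp_all add: \<theta>_def)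
  have nonneg: "0 \<le> lam N powr r * BL_dist (mu T) (mu_gal T N)" for N
    unfolding mu_eq mu_gal_eq using T
    by (intro mult_nonneg_nonneg BL_dist_nonneg heat_var_nonneg summable_heat_var galerkin_var_bounds
        summable_comparison_test'[OF summable_heat_var[of T]])
       (auto simp: galerkin_var_bounds)
  have upper: "lam N powr r * BL_dist (mu T) (mu_gal T N) \<le> K * lam N powr (r - \<theta> / 2)"
    if N: "0 < N" for N
  proof -
    have lam_pos: "0 < lam N" using lam_Suc_ge_1[of "N - 1"] N by simp
    have "BL_dist (mu T) (mu_gal T N) \<le> K * (1 / lam N) powr (\<theta> / 2)"
      unfolding mu_gal_eq K_def using T \<theta> lam_pos galerkin_var_diff_le[of T N \<theta>] N
      by (intro BL_dist_mu_le galerkin_var_bounds) auto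
    then have "lam N powr r * BL_dist (mu T) (mu_gal T N) \<le> lam N powr r * (K * (1 / lam N) powr (\<theta> / 2))"
      by (rule mult_left_mono) simp
    also have "\<dots> = K * lam N powr (r - \<theta> / 2)"
      using lam_pos by (simp add: powr_divide powr_diff)
    finally show ?thesis .
  qed
  have "filterlim lam at_top sequentially"
    unfolding lam_def by real_asymp
  then have "(\<lambda>N. lam N powr (r - \<theta> / 2)) \<longlonglongrightarrow> 0"
    using r by (intro tendsto_neg_powr) (simp_all add: \<theta>_def field_simps)
  then have lim: "(\<lambda>N. K * lam N powr (r - \<theta> / 2)) \<longlonglongrightarrow> 0"
    by (rule tendsto_mult_right_zero)
  have "(\<lambda>N. lam N powr r * BL_dist (mu T) (mu_gal T N)) \<longlonglongrightarrow> 0"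
    by (rule tendsto_sandwich[OF always_eventually eventually_mono[OF eventually_gt_at_top[of 0]] tendsto_const lim])
       (use nonneg upper in auto)
  then show ?thesis
    by (intro lim_imp_Limsup) (simp_all add: zero_ereal_def)
qed

text \<open>The weight is at least \<open>real N powr (2 * r)\<close> and the distance at least a
  constant times \<open>real N powr (- 1 / 2)\<close>; the combined exponent is positive for
  \<open>r > 1 / 4\<close>.\<close>

lemma galerkin_lower:
  assumes T: "0 < T" and r: "1 / 4 < r"
  shows "limsup (\<lambda>N. ereal (lam N powr r * BL_dist (mu T) (mu_gal T N))) = \<infinity>"
proof -
  have lower: "block_const * real N powr (2 * r - 1 / 2) \<le> lam N powr r * BL_dist (mu T) (mu_gal T N)"
    if N: "0 < N" "1 \<le> (real N)\<^sup>2 * T" for N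
  proof -
    have "real N powr (2 * r) \<le> (pi\<^sup>2) powr r * real N powr (2 * r)"
    proof -
      have "1\<^sup>2 \<le> pi\<^sup>2" using pi_ge_two by (intro power_mono) auto
      then have "1 powr r \<le> (pi\<^sup>2) powr r" using r by (intro powr_mono2) auto
      then show ?thesis by (simp add: mult_le_cancel_right1)
    qed
    then have lam_ge: "real N powr (2 * r) \<le> lam N powr r" by (simp add: lam_powr)
    have dist: "block_const / sqrt N \<le> BL_dist (mu T) (mu_gal T N)"
      unfolding mu_gal_eq using T N lam_Suc_ge_1
      by (intro BL_dist_mu_ge galerkin_var_bounds summable_comparison_test'[OF summable_heat_var[of T]])
         (auto simp: galerkin_var_bounds, auto simp: galerkin_var_def intro: order_trans[OF zero_le_one])
    have "block_const * real N powr (2 * r - 1 / 2) = real N powr (2 * r) * (block_const / sqrt N)"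
      using N by (simp add: powr_diff powr_half_sqrt)
    also have "\<dots> \<le> lam N powr r * BL_dist (mu T) (mu_gal T N)"
      using lam_ge dist block_const_pos by (intro mult_mono) auto
    finally show ?thesis .
  qed
  have "filterlim (\<lambda>N. real N powr (2 * r - 1 / 2)) at_top sequentially"
    using r by (intro filterlim_compose[OF powr_at_top filterlim_real_sequentially]) simp
  then have "filterlim (\<lambda>N. block_const * real N powr (2 * r - 1 / 2)) at_top sequentially"
    by (rule filterlim_tendsto_pos_mult_at_top[OF tendsto_const block_const_pos])
  moreover have "filterlim (\<lambda>N. (real N)\<^sup>2 * T) at_top sequentially"
    using T by real_asymp
  then have "eventually (\<lambda>N. 1 \<le> (real N)\<^sup>2 * T) sequentially"
    by (simp add: filterlim_at_top)
  then have "eventually (\<lambda>N. block_const * real N powr (2 * r - 1 / 2)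
      \<le> lam N powr r * BL_dist (mu T) (mu_gal T N)) sequentially"
    using eventually_gt_at_top[of 0] by eventually_elim (rule lower)
  ultimately have "filterlim (\<lambda>N. lam N powr r * BL_dist (mu T) (mu_gal T N)) at_top sequentially"
    by (rule filterlim_at_top_mono)
  then show ?thesis
    by (intro lim_imp_Limsup) (simp_all add: tendsto_PInfty_eq_at_top)
qed

lemma euler_upper:
  assumes T: "0 < T" and r: "0 \<le> r" "r < 1 / 4"
  shows "Limsup (at_right 0) (\<lambda>dt. ereal (BL_dist (mu T) (nu dt (nat \<lfloor>T / dt\<rfloor>)) / dt powr r)) = 0"
proof -
  define \<theta> where "\<theta> = r + 1 / 4"
  define C where "C = 1 + (1 + T) powr \<theta> * (1 / T) powr (1 - \<theta>)"
  define K where "K = sqrt (C * (\<Sum>k. lam (Suc k) powr (\<theta> - 1)) + 1)"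
  have \<theta>: "0 \<le> \<theta>" "\<theta> < 1 / 2" using r by (simp_all add: \<theta>_def)
  have C: "0 \<le> C" by (simp add: C_def)
  have bounds: "0 \<le> BL_dist (mu T) (nu dt (nat \<lfloor>T / dt\<rfloor>)) / dt powr r
      \<and> BL_dist (mu T) (nu dt (nat \<lfloor>T / dt\<rfloor>)) / dt powr r \<le> K * dt powr (\<theta> / 2 - r)"
    if dt: "0 < dt" "dt < T / 2" for dt
  proof
    note diff = euler_var_diff[OF dt(1) less_imp_le[OF dt(2)] refl \<theta>]
    have "summable (euler_var dt (nat \<lfloor>T / dt\<rfloor>))"
      by (rule summable_comparison_test'[OF summable_heat_var[of T]])
         (use T dt diff euler_var_nonneg in auto)
    then show "0 \<le> BL_dist (mu T) (nu dt (nat \<lfloor>T / dt\<rfloor>)) / dt powr r"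
      unfolding mu_eq nu_eq using T dt
      by (intro divide_nonneg_nonneg BL_dist_nonneg heat_var_nonneg summable_heat_var euler_var_nonneg) auto
    have "BL_dist (mu T) (nu dt (nat \<lfloor>T / dt\<rfloor>)) \<le> K * dt powr (\<theta> / 2)"
      unfolding nu_eq K_def using T dt C \<theta> diff[folded C_def]
      by (intro BL_dist_mu_le euler_var_nonneg) auto
    then have "BL_dist (mu T) (nu dt (nat \<lfloor>T / dt\<rfloor>)) / dt powr r \<le> K * dt powr (\<theta> / 2) / dt powr r"
      by (rule divide_right_mono) simp
    then show "BL_dist (mu T) (nu dt (nat \<lfloor>T / dt\<rfloor>)) / dt powr r \<le> K * dt powr (\<theta> / 2 - r)"
      by (simp add: powr_diff)
  qed
  have "((\<lambda>dt. dt powr (\<theta> / 2 - r)) \<longlongrightarrow> 0) (at_right 0)"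
  proof -
    have "0 < \<theta> / 2 - r" using r by (simp add: \<theta>_def field_simps)
    then show ?thesis by real_asymp
  qed
  then have lim: "((\<lambda>dt. K * dt powr (\<theta> / 2 - r)) \<longlongrightarrow> 0) (at_right 0)"
    by (rule tendsto_mult_right_zero)
  have ev: "eventually (\<lambda>dt. 0 < dt \<and> dt < T / 2) (at_right 0)"
    using eventually_at_right_real[of 0 "T / 2"] T by simp
  have "((\<lambda>dt. BL_dist (mu T) (nu dt (nat \<lfloor>T / dt\<rfloor>)) / dt powr r) \<longlongrightarrow> 0) (at_right 0)"
    by (rule tendsto_sandwich[OF eventually_mono[OF ev] eventually_mono[OF ev] tendsto_const lim])
       (use bounds in auto)
  then show ?thesis
    by (intro lim_imp_Limsup) (simp_all add: zero_ereal_def)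
qed

lemma euler_lower:
  assumes T: "0 < T" and r: "1 / 4 < r"
  shows "Limsup (at_right 0) (\<lambda>dt. ereal (BL_dist (mu T) (nu dt (nat \<lfloor>T / dt\<rfloor>)) / dt powr r)) = \<infinity>"
proof -
  have lower: "block_const / 2 * dt powr (1 / 4 - r) \<le> BL_dist (mu T) (nu dt (nat \<lfloor>T / dt\<rfloor>)) / dt powr r"
    if dt: "0 < dt" "dt < min 1 (T / 2)" for dt
  proof -
    \<comment> \<open>The least integer with \<open>N \<ge> 1 / sqrt dt\<close>. From mode
      \<open>N + 1\<close> on, \<open>dt * lam (Suc k) \<ge> 4\<close>, so the Euler variance is at
      most \<open>1 / (6 * lam (Suc k))\<close>. Rounding up costs at most a factor 2 because
      \<open>dt < 1\<close>.\<close>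
    define N where "N = nat \<lceil>dt powr (- 1 / 2)\<rceil>"
    have root: "1 \<le> dt powr (- 1 / 2)"
      using dt powr_mono2'[of "- 1 / 2" dt 1] by simp
    have N_ge: "dt powr (- 1 / 2) \<le> N" unfolding N_def by linarith
    have N_le: "N \<le> 2 * dt powr (- 1 / 2)" unfolding N_def using root by linarith
    have N_pos: "0 < N" using N_ge root by linarith
    have "(dt powr (- 1 / 2))\<^sup>2 \<le> (real N)\<^sup>2" using N_ge by (intro power_mono) auto
    moreover have "(dt powr (- 1 / 2))\<^sup>2 = 1 / dt"
      using dt by (simp add: power2_eq_square powr_minus_divide flip: powr_add)
    ultimately have "1 / dt \<le> (real N)\<^sup>2" by linarith
    then have N_dt: "1 \<le> (real N)\<^sup>2 * dt" using dt by (simp add: divide_le_eq)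
    also have "\<dots> \<le> (real N)\<^sup>2 * T" using dt by (intro mult_left_mono) auto
    finally have N_T: "1 \<le> (real N)\<^sup>2 * T" .
    have small: "euler_var dt m k \<le> 1 / (6 * lam (Suc k))" if "N \<le> k" for k m
    proof -
      have "(real N)\<^sup>2 \<le> (real (Suc k))\<^sup>2" using that by (intro power_mono) auto
      then have "4 * (real N)\<^sup>2 \<le> lam (Suc k)" using lam_Suc_ge[of k] by linarith
      then have "4 * (real N)\<^sup>2 * dt \<le> lam (Suc k) * dt" using dt by (intro mult_right_mono) auto
      then have "6 \<le> 2 + dt * lam (Suc k)" using N_dt by (simp add: mult.commute)
      then have "lam (Suc k) * 6 \<le> lam (Suc k) * (2 + dt * lam (Suc k))"
        using lam_Suc_ge_1[of k] by (intro mult_left_mono) auto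
      then have "1 / (lam (Suc k) * (2 + dt * lam (Suc k))) \<le> 1 / (lam (Suc k) * 6)"
        using lam_Suc_ge_1[of k] dt by (intro divide_left_mono mult_pos_pos add_pos_nonneg) auto
      then show ?thesis using euler_var_le[OF dt(1), of m k] by (simp add: mult.commute)
    qed
    \<comment> \<open>Only the ordering of the variances is used, so \<open>euler_var_diff\<close>
      is instantiated with \<open>\<theta> = 0\<close>.\<close>
    have "summable (euler_var dt (nat \<lfloor>T / dt\<rfloor>))"
      by (rule summable_comparison_test'[OF summable_heat_var[of T]])
         (use T dt euler_var_nonneg euler_var_diff(1)[of dt T _ 0] in auto)
    then have dist: "block_const / sqrt N \<le> BL_dist (mu T) (nu dt (nat \<lfloor>T / dt\<rfloor>))"
      unfolding nu_eq using N_pos N_T T dt small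
      by (intro BL_dist_mu_ge euler_var_nonneg) auto
    have "sqrt N \<le> sqrt (2\<^sup>2 * (dt powr (- 1 / 4))\<^sup>2)"
      using N_le by (simp add: power2_eq_square[of "_ powr _"] flip: powr_add)
    then have "sqrt N \<le> 2 * dt powr (- 1 / 4)" by (simp add: real_sqrt_mult)
    then have "block_const / (2 * dt powr (- 1 / 4)) \<le> block_const / sqrt N"
      using N_pos dt block_const_pos by (intro divide_left_mono) auto
    also note dist
    finally have "block_const / (2 * dt powr (- 1 / 4)) / dt powr r
        \<le> BL_dist (mu T) (nu dt (nat \<lfloor>T / dt\<rfloor>)) / dt powr r"
      by (rule divide_right_mono) simp
    also have "block_const / (2 * dt powr (- 1 / 4)) / dt powr r = block_const / 2 * dt powr (1 / 4 - r)"
      using dt by (simp add: powr_diff powr_minus_divide)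
    finally show ?thesis .
  qed
  have "filterlim (\<lambda>dt. dt powr (1 / 4 - r)) at_top (at_right 0)"
  proof -
    have "1 / 4 - r < 0" using r by simp
    then show ?thesis by real_asymp
  qed
  then have "filterlim (\<lambda>dt. block_const / 2 * dt powr (1 / 4 - r)) at_top (at_right 0)"
    using block_const_pos by (intro filterlim_tendsto_pos_mult_at_top[OF tendsto_const]) auto
  moreover have "eventually (\<lambda>dt. 0 < dt \<and> dt < min 1 (T / 2)) (at_right 0)"
    using eventually_at_right_real[of 0 "min 1 (T / 2)"] T by simp
  then have "eventually (\<lambda>dt. block_const / 2 * dt powr (1 / 4 - r)
      \<le> BL_dist (mu T) (nu dt (nat \<lfloor>T / dt\<rfloor>)) / dt powr r) (at_right 0)"
    by eventually_elim (use lower in blast)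
  ultimately have "filterlim (\<lambda>dt. BL_dist (mu T) (nu dt (nat \<lfloor>T / dt\<rfloor>)) / dt powr r) at_top (at_right 0)"
    by (rule filterlim_at_top_mono)
  then show ?thesis
    by (intro lim_imp_Limsup) (simp_all add: tendsto_PInfty_eq_at_top)
qed

theorem theorem3p2:
  fixes T :: real
  assumes "0 < T"
  shows "(\<forall>r::real. 0 \<le> r \<and> r < 1/4 \<longrightarrow>
            limsup (\<lambda>N. ereal (lam N powr r * BL_dist (mu T) (mu_gal T N))) = 0)
       \<and> (\<forall>r::real. 1/4 < r \<and> r < 1/2 \<longrightarrow>
            limsup (\<lambda>N. ereal (lam N powr r * BL_dist (mu T) (mu_gal T N))) = \<infinity>)
       \<and> (\<forall>r::real. 0 \<le> r \<and> r < 1/4 \<longrightarrow>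
            Limsup (at_right 0) (\<lambda>dt. ereal (BL_dist (mu T) (nu dt (nat \<lfloor>T / dt\<rfloor>)) / dt powr r)) = 0)
       \<and> (\<forall>r::real. 1/4 < r \<and> r < 1/2 \<longrightarrow>
            Limsup (at_right 0) (\<lambda>dt. ereal (BL_dist (mu T) (nu dt (nat \<lfloor>T / dt\<rfloor>)) / dt powr r)) = \<infinity>)"
  using galerkin_upper[OF assms] galerkin_lower[OF assms] euler_upper[OF assms] euler_lower[OF assms]
  by blast

end
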